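(* Let $d\ge 2$ and let $f(X_1,\dots,X_{d-1})$ be a polynomial with integer coefficients in which the order of multiplication of the variables in each monomial is fixed (i.e. a $\mathbb{Z}$-linear combination of words in $X_1,\dots,X_{d-1}$). For a finite ring $R$ let $V_f(R)=\{(x_1,\dots,x_d)\in R^d : x_d=f(x_1,\dots,x_{d-1})\}$. Let $\{R_i\}_{i=1}^\infty$ be a sequence of finite rings with $|R_i|\to\infty$, and suppose that there is a constant $C$ such that $V_f(R_i)$ is a $C$-Salem set in $R_i^d$ for every $i$. Then all but finitely many of the rings $R_i$ are fields or are isomorphic to matrix rings $M_{n\times n}(F)$, $F$ a finite field, of small dimension relative to $d$. Moreover, in the case $f(X_1,\dots,X_{d-1})=X_1^2+\dots+X_{d-1}^2$, all but finitely many of the rings $R_i$ are fields.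
   Context: Rings are unital with $1\neq 0$ and not necessarily commutative. For a finite ring $R$, a set $S\subseteq R^d$ and a character $\psi$ of the additive group of $R^d$, put $\widehat{S}(\psi)=\frac{1}{|R|^d}\sum_{x\in S}\psi(x)$. The set $S$ is called $C$-Salem if $|\widehat{S}(\psi)|\le C\,|R|^{-d}\,|S|^{1/2}$ for all nontrivial additive characters $\psi$ of $R^d$. A matrix ring $M_{n\times n}(F)$ over a finite field $F$ is said to have small dimension relative to $d$ if one of the following holds: $n=2$; or $n=3$ and $d\in\{2,3\}$; or $n=4$ and $d=2$. *)

theory Defs
  imports
    Complex_Main
    "HOL-Algebra.QuotRing"
    "HOL-Algebra.Product_Groups"
    "HOL-Library.Poly_Mapping"
    "HOL-Library.Infinite_Set"
begin

text \<open>The additive group of \<open>R\<^sup>d\<close>; points are extensional functions on \<open>{1..d}\<close>.\<close>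

definition power_group :: "nat \<Rightarrow> 'a ring \<Rightarrow> (nat \<Rightarrow> 'a) monoid" where
  "power_group d R = product_group {1..d} (\<lambda>_. add_monoid R)"

definition circle_group :: "complex monoid" where
  "circle_group = \<lparr>carrier = {z. cmod z = 1}, monoid.mult = (*), one = 1\<rparr>"

definition nontrivial_characters :: "nat \<Rightarrow> 'a ring \<Rightarrow> ((nat \<Rightarrow> 'a) \<Rightarrow> complex) set" where
  "nontrivial_characters d R =
     {\<psi> \<in> hom (power_group d R) circle_group. \<exists>x\<in>carrier (power_group d R). \<psi> x \<noteq> 1}"

definition fourier_coeff ::
  "nat \<Rightarrow> 'a ring \<Rightarrow> (nat \<Rightarrow> 'a) set \<Rightarrow> ((nat \<Rightarrow> 'a) \<Rightarrow> complex) \<Rightarrow> complex" where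
  "fourier_coeff d R S \<psi> = 1 / of_nat (card (carrier R)) ^ d * (\<Sum>x\<in>S. \<psi> x)"

definition salem_set :: "real \<Rightarrow> nat \<Rightarrow> 'a ring \<Rightarrow> (nat \<Rightarrow> 'a) set \<Rightarrow> bool" where
  "salem_set C d R S \<longleftrightarrow> S \<subseteq> carrier (power_group d R) \<and>
     (\<forall>\<psi>\<in>nontrivial_characters d R.
        cmod (fourier_coeff d R S \<psi>) \<le> C / real (card (carrier R)) ^ d * sqrt (real (card S)))"

text \<open>A noncommutative integer polynomial is a finitely supported map from words to integer
  coefficients, where a word is the list of its variable indices. The empty word is the
  constant monomial.\<close>

type_synonym ncpoly = "nat list \<Rightarrow>\<^sub>0 int"

definition ncpolys :: "nat \<Rightarrow> ncpoly set" where
  "ncpolys m = {f. Poly_Mapping.keys f \<subseteq> lists {1..m}}"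

definition eval_word :: "'a ring \<Rightarrow> (nat \<Rightarrow> 'a) \<Rightarrow> nat list \<Rightarrow> 'a" where
  "eval_word R x w = foldr (\<lambda>i a. x i \<otimes>\<^bsub>R\<^esub> a) w \<one>\<^bsub>R\<^esub>"

definition eval_ncpoly :: "'a ring \<Rightarrow> (nat \<Rightarrow> 'a) \<Rightarrow> ncpoly \<Rightarrow> 'a" where
  "eval_ncpoly R x f =
     (\<Oplus>\<^bsub>R\<^esub>w\<in>Poly_Mapping.keys f. [Poly_Mapping.lookup f w] \<cdot>\<^bsub>R\<^esub> eval_word R x w)"

definition sum_of_squares_poly :: "nat \<Rightarrow> ncpoly" where
  "sum_of_squares_poly m = (\<Sum>i=1..m. Poly_Mapping.single [i, i] 1)"

definition graph_variety :: "nat \<Rightarrow> ncpoly \<Rightarrow> 'a ring \<Rightarrow> (nat \<Rightarrow> 'a) set" where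
  "graph_variety d f R = {x \<in> carrier (power_group d R). x d = eval_ncpoly R x f}"

text \<open>Matrices are extensional functions on \<open>{1..n} \<times> {1..n}\<close>.\<close>

definition matrix_ring :: "nat \<Rightarrow> 'a ring \<Rightarrow> (nat \<times> nat \<Rightarrow> 'a) ring" where
  "matrix_ring n F =
     \<lparr>carrier = {1..n} \<times> {1..n} \<rightarrow>\<^sub>E carrier F,
      monoid.mult = (\<lambda>A B. \<lambda>(i, j)\<in>{1..n} \<times> {1..n}. \<Oplus>\<^bsub>F\<^esub>k\<in>{1..n}. A (i, k) \<otimes>\<^bsub>F\<^esub> B (k, j)),
      one = (\<lambda>(i, j)\<in>{1..n} \<times> {1..n}. if i = j then \<one>\<^bsub>F\<^esub> else \<zero>\<^bsub>F\<^esub>),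
      zero = (\<lambda>(i, j)\<in>{1..n} \<times> {1..n}. \<zero>\<^bsub>F\<^esub>),
      add = (\<lambda>A B. \<lambda>(i, j)\<in>{1..n} \<times> {1..n}. A (i, j) \<oplus>\<^bsub>F\<^esub> B (i, j))\<rparr>"

definition small_dimension :: "nat \<Rightarrow> nat \<Rightarrow> bool" where
  "small_dimension d n \<longleftrightarrow> n = 2 \<or> n = 3 \<and> d \<in> {2, 3} \<or> n = 4 \<and> d = 2"

text \<open>Taking \<open>F\<close> over the element type of \<open>R\<close> loses nothing: a ring isomorphic to
  \<open>matrix_ring n F\<close> with \<open>n \<ge> 1\<close> contains a copy of \<open>F\<close> as its scalar matrices.\<close>

definition is_small_matrix_ring :: "nat \<Rightarrow> 'a ring \<Rightarrow> bool" where
  "is_small_matrix_ring d R \<longleftrightarrow>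
     (\<exists>n (F :: 'a ring). field F \<and> finite (carrier F) \<and> small_dimension d n \<and> R \<simeq> matrix_ring n F)"

end

theory Submission
  imports
    Defs
    "HOL-Algebra.Group_Action"
    "HOL-Algebra.Subrings"
    "HOL-Algebra.Multiplicative_Group"
    "HOL-Computational_Algebra.Fundamental_Theorem_Algebra"
begin

text \<open>
  Write \<open>N\<close> for the order of the ring. Averaging the character sums over the characters that are
  trivial on \<open>A\<^sup>d\<close>, for a proper unital subring \<open>A\<close>, counts the \<open>|A|\<^bsup>d-1\<^esup>\<close> points of the graph in \<open>A\<^sup>d\<close>;
  comparison with the Salem bound gives \<open>|A|\<^sup>2 = O(N)\<close>. Averaging their squares over the characters trivial
  on \<open>I\<^sup>d\<close>, for a proper two-sided ideal \<open>I\<close>, counts pairs of points congruent modulo \<open>I\<close> and gives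
  \<open>|I| = O(1)\<close>. Hence a large ring is simple, since the annihilator of a small nonzero ideal is a large
  ideal. If it is not a division ring, a minimal left ideal is generated by an idempotent \<open>e\<close>; with
  \<open>f = 1 - e\<close> the subrings \<open>{x. fxe = 0}\<close> and \<open>{x. exf = 0}\<close> (block triangular matrices) exceed the bound
  \<open>O(N\<^bsup>1/2\<^esup>)\<close>. So a large ring is a finite division ring, hence a field by Wedderburn's little theorem. In
  particular the matrix rings of small dimension occur only finitely often, and both claims follow.
\<close>

text \<open>The two counts use different moments for a reason. A unital subring contains the value
  of every word, the empty one included, so points of the graph can be counted inside it directly. A
  proper ideal lacks \<open>1\<close>, and a constant term may lead out of it; but evaluation
  respects congruence modulo the ideal, so differences of points are counted instead, and squared
  character sums detect these. In both counts the trivial character contributes at most half of the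
  total, because a proper additive subgroup has index at least 2. What remains is controlled by
  \<open>C\<close>. From there on only cardinalities are compared, with one constant
  \<open>B\<close> depending on \<open>C\<close>. Non-division rings are excluded through the sizes
  of the corners cut out by \<open>e\<close> and \<open>f\<close>, so the argument needs no
  classification of simple rings. The cyclotomic values serve only the passage from finite division
  rings to fields.\<close>

section \<open>Values of cyclotomic polynomials\<close>

text \<open>The coefficient of \<open>g * h\<close> at index \<open>degree g + i\<close> is
  \<open>coeff h i\<close>, coming from the leading 1 of \<open>g\<close>, plus terms that involve
  only higher coefficients of \<open>h\<close>. Hence a downward induction on
  \<open>i\<close>.\<close>

lemma int_coeffs_div_monic:
  fixes g h :: "complex poly"
  assumes g: "\<And>i. coeff g i \<in> \<int>" and gh: "\<And>i. coeff (g * h) i \<in> \<int>" and monic: "lead_coeff g = 1"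
  shows "coeff h i \<in> \<int>"
proof (induction "Suc (degree h) - i" arbitrary: i rule: less_induct)
  case less
  show ?case
  proof (cases "i > degree h")
    case True
    then show ?thesis by (simp add: coeff_eq_0)
  next
    case False
    let ?m = "degree g"
    have "coeff (g * h) (?m + i) = (\<Sum>j\<le>?m + i. coeff g j * coeff h (?m + i - j))"
      by (rule coeff_mult)
    also have "\<dots> = coeff h i + (\<Sum>j\<in>{..?m + i} - {?m}. coeff g j * coeff h (?m + i - j))"
      by (subst sum.remove[of _ ?m]) (use monic in auto)
    finally have "coeff h i =
        coeff (g * h) (?m + i) - (\<Sum>j\<in>{..?m + i} - {?m}. coeff g j * coeff h (?m + i - j))"
      by simp
    moreover have "coeff g j * coeff h (?m + i - j) \<in> \<int>" if "j \<in> {..?m + i} - {?m}" for j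
    proof (cases "j > ?m")
      case True
      then show ?thesis by (simp add: coeff_eq_0)
    next
      case False
      then have "coeff h (?m + i - j) \<in> \<int>"
        using that \<open>\<not> i > degree h\<close> by (intro less) auto
      then show ?thesis using g by simp
    qed
    ultimately show ?thesis using gh by (auto intro!: Ints_diff Ints_sum)
  qed
qed

text \<open>For \<open>n > 0\<close> these are the elements of exact order \<open>n\<close>. At
  \<open>n = 0\<close> both conditions are void and the set is the whole plane, so positive indices
  are assumed where it matters.\<close>

definition primitive_roots :: "nat \<Rightarrow> complex set" where
  "primitive_roots n = {w. w ^ n = 1 \<and> (\<forall>d. 0 < d \<and> d < n \<longrightarrow> w ^ d \<noteq> 1)}"

definition cyclotomic :: "nat \<Rightarrow> complex poly" where
  "cyclotomic n = (\<Prod>w\<in>primitive_roots n. [:-w, 1:])"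

text \<open>The derivative \<open>n X^(n-1)\<close> vanishes at most at 0, which is not a root, so
  the polynomial is squarefree and splits into distinct linear factors.\<close>

lemma unity_poly_eq_prod:
  assumes "n > 0"
  shows "monom 1 n - 1 = (\<Prod>w | w ^ n = 1. [:-w, 1 :: complex:])"
proof -
  let ?p = "monom 1 n - 1 :: complex poly"
  have roots: "poly ?p w = 0 \<longleftrightarrow> w ^ n = 1" for w
    by (simp add: poly_monom)
  have deg: "degree ?p = n"
    unfolding diff_conv_add_uminus using assms by (subst degree_add_eq_left) (simp_all add: degree_monom_eq)
  have "coeff ?p n = 1"
    using assms by simp
  moreover have "rsquarefree ?p"
    unfolding rsquarefree_roots
  proof (intro allI notI, elim conjE)
    fix a assume "poly ?p a = 0" "poly (pderiv ?p) a = 0"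
    then have "a ^ n = 1" "a ^ (n - 1) = 0"
      using assms by (auto simp: roots pderiv_diff pderiv_monom poly_monom)
    then show False
      using assms by (auto simp: power_0_left split: if_splits)
  qed
  ultimately show ?thesis
    using complex_poly_decompose_rsquarefree[of ?p] deg roots by simp
qed

lemma finite_primitive_roots: "n > 0 \<Longrightarrow> finite (primitive_roots n)"
  by (rule finite_subset[OF _ finite_roots_unity[of n]]) (auto simp: primitive_roots_def)

lemma primitive_root_exists_divisor:
  assumes "n > 0" "w ^ n = 1"
  obtains d where "d dvd n" "w \<in> primitive_roots d"
proof -
  define d where "d = (LEAST d. 0 < d \<and> w ^ d = 1)"
  have d: "0 < d" "w ^ d = 1"
    using LeastI[of "\<lambda>d. 0 < d \<and> w ^ d = 1" n] assms unfolding d_def by auto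
  have least: "w ^ k \<noteq> 1" if "0 < k" "k < d" for k
    using not_less_Least[of k "\<lambda>d. 0 < d \<and> w ^ d = 1"] that unfolding d_def by auto
  have "w ^ n = (w ^ d) ^ (n div d) * w ^ (n mod d)"
    by (metis mult_div_mod_eq power_add power_mult)
  then have "w ^ (n mod d) = 1"
    using d assms by simp
  then have "n mod d = 0"
    using least[of "n mod d"] d by (cases "n mod d = 0") auto
  then show ?thesis
    using that[of d] d least by (auto simp: primitive_roots_def dvd_eq_mod_eq_0)
qed

lemma primitive_roots_disjoint:
  assumes "0 < d" "0 < k" "d \<noteq> k"
  shows "primitive_roots d \<inter> primitive_roots k = {}"
  using assms by (auto simp: primitive_roots_def) (metis linorder_neqE_nat)

lemma primitive_roots_subset:
  assumes "d dvd n" "w \<in> primitive_roots d"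
  shows "w ^ n = 1"
  using assms by (auto simp: primitive_roots_def power_mult)

lemma unity_poly_eq_prod_cyclotomic:
  assumes "n > 0"
  shows "monom 1 n - 1 = (\<Prod>d | d dvd n. cyclotomic d)"
proof -
  have "{w. w ^ n = 1} = (\<Union>d\<in>{d. d dvd n}. primitive_roots d)"
    using primitive_root_exists_divisor[OF assms] primitive_roots_subset by blast
  then have "monom 1 n - 1 = (\<Prod>w\<in>(\<Union>d\<in>{d. d dvd n}. primitive_roots d). [:-w, 1:])"
    using unity_poly_eq_prod[OF assms] by simp
  also have "\<dots> = (\<Prod>d | d dvd n. cyclotomic d)"
    unfolding cyclotomic_def using assms
    by (intro prod.UNION_disjoint)
      (use primitive_roots_disjoint in \<open>auto intro!: finite_primitive_roots simp: dvd_pos_nat\<close>)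
  finally show ?thesis .
qed

lemma lead_coeff_linear_prod: "lead_coeff (\<Prod>w\<in>S. [:-w, 1 :: complex:]) = 1"
  by (simp add: lead_coeff_prod)

lemma int_coeffs_mult:
  fixes p q :: "complex poly"
  assumes "\<And>i. coeff p i \<in> \<int>" "\<And>i. coeff q i \<in> \<int>"
  shows "coeff (p * q) i \<in> \<int>"
  using assms by (auto simp: coeff_mult intro!: Ints_sum Ints_mult)

lemma int_coeffs_prod:
  assumes "\<And>x i. x \<in> S \<Longrightarrow> coeff (p x :: complex poly) i \<in> \<int>"
  shows "coeff (\<Prod>x\<in>S. p x) i \<in> \<int>"
  using assms
proof (induction S arbitrary: i rule: infinite_finite_induct)
  case (insert x F)
  then show ?case by (simp add: int_coeffs_mult)
qed (auto simp: coeff_1 split: if_splits)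

lemma int_coeffs_unity_poly: "coeff (monom 1 n - 1 :: complex poly) i \<in> \<int>"
  by (auto simp: coeff_1 split: if_splits)

text \<open>Strong induction: the factor of \<open>X^n - 1\<close> that belongs to the proper
  divisors of \<open>n\<close> is monic with integer coefficients, and division by such a factor
  preserves integrality.\<close>

lemma int_coeffs_cyclotomic: "n > 0 \<Longrightarrow> coeff (cyclotomic n) i \<in> \<int>"
proof (induction n arbitrary: i rule: less_induct)
  case (less n)
  let ?g = "\<Prod>d\<in>{d. d dvd n} - {n}. cyclotomic d"
  have eq: "monom 1 n - 1 = ?g * cyclotomic n"
    using less.prems unity_poly_eq_prod_cyclotomic[of n]
    by (subst mult.commute, subst prod.remove[symmetric]) auto
  have "coeff ?g i \<in> \<int>" for i
    using less by (intro int_coeffs_prod less.IH) (auto dest: dvd_imp_le simp: dvd_pos_nat)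
  moreover have "lead_coeff ?g = 1"
    unfolding lead_coeff_prod
    by (auto intro!: prod.neutral simp: cyclotomic_def lead_coeff_linear_prod)
  ultimately show ?case
    using int_coeffs_div_monic[of ?g "cyclotomic n"] int_coeffs_unity_poly[of n] eq by metis
qed

lemma poly_int_coeffs_in_Ints:
  fixes p :: "complex poly"
  assumes "\<And>i. coeff p i \<in> \<int>" "x \<in> \<int>"
  shows "poly p x \<in> \<int>"
  using assms by (auto simp: poly_altdef intro!: Ints_sum Ints_mult Ints_power)

lemma norm_diff_root_of_unity_gt:
  assumes "cmod w = 1" "w \<noteq> 1" "q > 0"
  shows "cmod (of_nat q - w) > real q - 1"
proof -
  have "(Re w)\<^sup>2 + (Im w)\<^sup>2 = 1"
    using assms(1) by (simp add: cmod_def)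
  moreover have "Re w < 1"
  proof (rule ccontr)
    assume "\<not> Re w < 1"
    moreover have "Re w \<le> 1" using complex_Re_le_cmod[of w] assms by simp
    ultimately have "Re w = 1" by simp
    with \<open>(Re w)\<^sup>2 + (Im w)\<^sup>2 = 1\<close> have "w = 1" by (simp add: complex_eq_iff)
    with assms show False by simp
  qed
  ultimately have "real q - Re w > real q - 1" by simp
  also have "real q - Re w \<le> cmod (of_nat q - w)"
    using complex_Re_le_cmod[of "of_nat q - w"] by simp
  finally show ?thesis .
qed

text \<open>\<open>k\<close> is the value of the \<open>n\<close>-th cyclotomic polynomial at
  \<open>q\<close>. Phrased purely in integers, this is the arithmetic input to Witt's proof of
  Wedderburn's theorem.\<close>

lemma cyclotomic_value_exists:
  fixes n q :: nat
  assumes "n \<ge> 2" "q \<ge> 2"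
  obtains k :: int where "\<bar>k\<bar> > int q - 1"
    and "\<And>d. d dvd n \<Longrightarrow> d < n \<Longrightarrow> k * (int q ^ d - 1) dvd int q ^ n - 1"
proof -
  have n0: "n > 0" using assms by simp
  let ?x = "of_nat q :: complex"
  obtain k where k: "poly (cyclotomic n) ?x = of_int k"
    using poly_int_coeffs_in_Ints[of "cyclotomic n" ?x] int_coeffs_cyclotomic n0
    by (metis Ints_cases Ints_of_nat)
  \<comment> \<open>A primitive root has to be exhibited: over an empty index set the product below
    would be 1, and the strict bound would fail.\<close>
  have prim: "cis (2 * pi / real n) \<in> primitive_roots n"
  proof -
    have "cis (2 * pi * real j / real n) \<noteq> 1" if "0 < j" "j < n" for j
    proof
      assume "cis (2 * pi * real j / real n) = 1"
      then have "cis (2 * pi * real j / real n) = cis (2 * pi * real 0 / real n)" by simp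
      then have "j = 0"
        using inj_onD[OF bij_betw_imp_inj_on[OF bij_betw_roots_unity[OF n0]], of j 0] that n0 by simp
      with that show False by simp
    qed
    then show ?thesis
      using n0 by (auto simp: primitive_roots_def DeMoivre mult_ac cis_2pi[unfolded mult.commute[of 2 pi]])
  qed
  have "\<bar>real_of_int k\<bar> = cmod (poly (cyclotomic n) ?x)"
    by (simp add: k)
  also have "\<dots> = (\<Prod>w\<in>primitive_roots n. cmod (?x - w))"
    by (simp add: cyclotomic_def poly_prod prod_norm)
  also have "\<dots> > real q - 1"
  proof -
    let ?w = "cis (2 * pi / real n)"
    have gt: "cmod (?x - w) > real q - 1" if "w \<in> primitive_roots n" for w
    proof (rule norm_diff_root_of_unity_gt)
      have "w ^ n = 1" "w ^ 1 \<noteq> 1"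
        using that assms by (auto simp: primitive_roots_def)
      then show "cmod w = 1" "w \<noteq> 1"
        using n0 power_eq_imp_eq_base[of "cmod w" n 1]
        by (auto simp: norm_power[symmetric])
    qed (use assms in auto)
    \<comment> \<open>Since \<open>q \<ge> 2\<close>, the remaining factors are at least 1, so the
      single factor at \<open>?w\<close> already gives the bound.\<close>
    have "1 \<le> (\<Prod>w\<in>primitive_roots n - {?w}. cmod (?x - w))"
      using gt assms by (intro prod_ge_1) (force simp: less_imp_le)
    moreover have "(\<Prod>w\<in>primitive_roots n. cmod (?x - w)) =
        cmod (?x - ?w) * (\<Prod>w\<in>primitive_roots n - {?w}. cmod (?x - w))"
      using prim finite_primitive_roots[OF n0] by (rule prod.remove[rotated])
    ultimately have "(\<Prod>w\<in>primitive_roots n. cmod (?x - w)) \<ge> cmod (?x - ?w)"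
      by (simp add: mult_le_cancel_left1)
    with gt[OF prim] show ?thesis by simp
  qed
  finally have "\<bar>k\<bar> > int q - 1" by linarith
  moreover have "k * (int q ^ d - 1) dvd int q ^ n - 1" if d: "d dvd n" "d < n" for d
  proof -
    have d0: "d > 0" using d n0 by (auto intro: dvd_pos_nat)
    let ?g = "cyclotomic n * (monom 1 d - 1)"
    let ?D = "{e. e dvd n} - {n} - {e. e dvd d}"
    \<comment> \<open>\<open>h\<close> belongs to the divisors of \<open>n\<close> that are neither
      \<open>n\<close> itself nor divisors of \<open>d\<close>: it is what remains of
      \<open>X^n - 1\<close> once \<open>cyclotomic n\<close> and \<open>X^d - 1\<close> are split
      off.\<close>
    define h where "h = (\<Prod>e\<in>?D. cyclotomic e)"
    have "monom 1 n - 1 = cyclotomic n * (\<Prod>e\<in>{e. e dvd n} - {n}. cyclotomic e)"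
      unfolding unity_poly_eq_prod_cyclotomic[OF n0] using n0 by (intro prod.remove) auto
    also have "(\<Prod>e\<in>{e. e dvd n} - {n}. cyclotomic e) = h * (\<Prod>e | e dvd d. cyclotomic e)"
      unfolding h_def
    proof (rule prod.subset_diff)
      show "{e. e dvd d} \<subseteq> {e. e dvd n} - {n}"
        using d d0 dvd_trans[of _ d n] by (auto dest: dvd_imp_le)
    qed (use n0 in simp)
    finally have eq: "monom 1 n - 1 = ?g * h"
      unfolding unity_poly_eq_prod_cyclotomic[OF d0] by (simp add: mult_ac)
    have "coeff h i \<in> \<int>" for i
      unfolding h_def using n0 by (intro int_coeffs_prod int_coeffs_cyclotomic) (auto simp: dvd_pos_nat)
    then obtain l where l: "poly h ?x = of_int l"
      using poly_int_coeffs_in_Ints[of h ?x] by (metis Ints_cases Ints_of_nat)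
    have "poly (monom 1 n - 1) ?x = poly (?g * h) ?x" by (simp only: eq)
    then have "of_int (int q ^ n - 1) = (of_int (k * (int q ^ d - 1) * l) :: complex)"
      by (simp add: poly_monom k l mult_ac)
    then have "int q ^ n - 1 = k * (int q ^ d - 1) * l"
      by (simp only: of_int_eq_iff)
    then show ?thesis by simp
  qed
  ultimately show ?thesis by (rule that)
qed

section \<open>Wedderburn's little theorem\<close>

text \<open>Multiplication by \<open>x\<close> is injective on the finite set \<open>K\<close>,
  hence permutes it and reaches \<open>\<one>\<close>.\<close>

lemma (in ring) division_subring_inv_closed:
  assumes "finite (carrier R)" "Units R = carrier R - {\<zero>}" "subring K R" "x \<in> K" "x \<noteq> \<zero>"
  shows "inv x \<in> K"
proof -
  have K: "K \<subseteq> carrier R" "finite K"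
    using subringE(1)[OF assms(3)] finite_subset[OF _ assms(1)] by auto
  have x: "x \<in> Units R" using assms K by auto
  have "inj_on (\<lambda>y. x \<otimes> y) K"
    using x K by (intro inj_onI) (metis Units_l_cancel subsetD)
  moreover have "(\<lambda>y. x \<otimes> y) ` K \<subseteq> K"
    using assms subringE(6)[OF assms(3)] by blast
  ultimately have "(\<lambda>y. x \<otimes> y) ` K = K"
    using K by (simp add: card_image card_subset_eq)
  then obtain y where y: "y \<in> K" "x \<otimes> y = \<one>"
    using subringE(3)[OF assms(3)] by (metis imageE)
  have "inv x = inv x \<otimes> (x \<otimes> y)"
    using x y by simp
  also have "\<dots> = y"
    using x y K by (subst m_assoc[symmetric]) (auto simp: Units_closed Units_l_inv)
  finally have "y = inv x" by simp
  with y show ?thesis by simp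
qed

lemma (in abelian_group) add_eq_add_imp_minus_eq:
  assumes eq: "a \<oplus> u = b \<oplus> w"
    and [simp]: "a \<in> carrier G" "b \<in> carrier G" "u \<in> carrier G" "w \<in> carrier G"
  shows "a \<ominus> b = w \<ominus> u"
proof -
  have "a = (a \<oplus> u) \<ominus> u"
    by (simp add: a_minus_def a_assoc r_neg)
  also have "\<dots> = (w \<ominus> u) \<oplus> b"
    unfolding eq by (simp add: a_minus_def a_ac)
  finally show ?thesis
    by (simp add: a_minus_def a_assoc r_neg)
qed

text \<open>\<open>W\<close> is a left vector space over the division ring \<open>K\<close>. In
  place of a basis, a \<open>K\<close>-stable subgroup \<open>V\<close> of \<open>W\<close> of
  largest cardinality among those whose order is a power of \<open>card K\<close> is taken; a vector
  \<open>v\<close> outside \<open>V\<close> would make \<open>K v + V\<close> larger by the factor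
  \<open>card K\<close>. The lemma is applied to the centre and to centralizers, which may be
  noncommutative.\<close>

lemma (in ring) card_subspace_eq_power:
  assumes fin: "finite (carrier R)" and div: "Units R = carrier R - {\<zero>}" and K: "subring K R"
    and W: "subgroup W (add_monoid R)" "\<And>k w. k \<in> K \<Longrightarrow> w \<in> W \<Longrightarrow> k \<otimes> w \<in> W"
  shows "\<exists>m. card W = card K ^ m"
proof -
  note Kc = subringE[OF K]
  have subgrp: "V \<subseteq> carrier R" "\<zero> \<in> V" "a \<in> V \<Longrightarrow> b \<in> V \<Longrightarrow> a \<oplus> b \<in> V" "a \<in> V \<Longrightarrow> \<ominus> a \<in> V"
    if "subgroup V (add_monoid R)" for V a b
    using subgroup.subset[OF that] subgroup.one_closed[OF that] subgroup.m_closed[OF that]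
      subgroup.m_inv_closed[OF that] by (auto simp: a_inv_def)
  define S where "S = {V. subgroup V (add_monoid R) \<and> (\<forall>k\<in>K. \<forall>w\<in>V. k \<otimes> w \<in> V) \<and>
    V \<subseteq> W \<and> (\<exists>m. card V = card K ^ m)}"
  have finW: "finite W" using subgrp(1)[OF W(1)] fin finite_subset by blast
  have "{\<zero>} \<in> S"
    unfolding S_def using add.triv_subgroup subgrp(2)[OF W(1)] Kc(1)
    by (auto simp: subset_iff intro!: exI[of _ 0])
  moreover have "finite S"
    by (rule finite_subset[of _ "Pow W"]) (auto simp: S_def finW)
  ultimately obtain V where V: "V \<in> S" and max: "\<And>V'. V' \<in> S \<Longrightarrow> card V' \<le> card V"
    using Max_in[of "card ` S"] Max_ge[of "card ` S"]
    by (metis (no_types, lifting) empty_iff finite_imageI imageE imageI)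
  have Vsub: "subgroup V (add_monoid R)" and VK: "\<And>k w. k \<in> K \<Longrightarrow> w \<in> V \<Longrightarrow> k \<otimes> w \<in> V"
    and VW: "V \<subseteq> W" using V by (auto simp: S_def)
  obtain m where m: "card V = card K ^ m" using V by (auto simp: S_def)
  have "W \<subseteq> V"
  proof (rule ccontr)
    assume "\<not> W \<subseteq> V"
    then obtain v where v: "v \<in> W" "v \<notin> V" by blast
    have vR: "v \<in> carrier R" using v subgrp(1)[OF W(1)] by blast
    note VR = subsetD[OF subgrp(1)[OF Vsub]] and KR = subsetD[OF Kc(1)]
    let ?h = "\<lambda>(k, u). k \<otimes> v \<oplus> u"
    let ?V = "?h ` (K \<times> V)"
    \<comment> \<open>Injectivity expresses that \<open>v\<close> is independent of
      \<open>V\<close>: a nonzero \<open>?c\<close> could be inverted inside \<open>K\<close>, which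
      would put \<open>v\<close> into \<open>V\<close>.\<close>
    have "inj_on ?h (K \<times> V)"
    proof (rule inj_onI, clarify)
      fix k u k' u' assume *: "k \<in> K" "u \<in> V" "k' \<in> K" "u' \<in> V" "k \<otimes> v \<oplus> u = k' \<otimes> v \<oplus> u'"
      let ?c = "k \<ominus> k'"
      have cK: "?c \<in> K" using * Kc by (simp add: a_minus_def)
      have c: "?c \<otimes> v = u' \<ominus> u"
        using add_eq_add_imp_minus_eq[OF *(5)] *(1-4) vR VR KR
        by (simp add: l_distr a_minus_def l_minus)
      have "?c = \<zero>"
      proof (rule ccontr)
        assume "?c \<noteq> \<zero>"
        then have "inv ?c \<in> K" "?c \<in> Units R"
          using division_subring_inv_closed[OF fin div K cK] cK KR div by auto
        then have "inv ?c \<otimes> (?c \<otimes> v) \<in> V"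
          unfolding c using * subgrp(3,4)[OF Vsub] VK by (simp add: a_minus_def)
        moreover have "inv ?c \<otimes> (?c \<otimes> v) = v"
          using \<open>?c \<in> Units R\<close> vR by (subst m_assoc[symmetric]) (auto simp: Units_closed Units_l_inv)
        ultimately show False using v by simp
      qed
      then have "k = k'" using * KR by (simp add: r_right_minus_eq)
      with * VR KR vR show "k = k' \<and> u = u'" by simp
    qed
    then have "card ?V = card K ^ Suc m"
      using m by (simp add: card_image card_cartesian_product)
    moreover have "?V \<in> S"
    proof -
      have "subgroup ?V (add_monoid R)"
      proof (rule add.subgroupI)
        show "?V \<subseteq> carrier R" using vR VR KR by auto
        show "?V \<noteq> {}" using Kc(2) subgrp(2)[OF Vsub] by blast
        show "\<ominus> a \<in> ?V" if "a \<in> ?V" for a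
        proof -
          from that obtain k u where "k \<in> K" "u \<in> V" "a = k \<otimes> v \<oplus> u" by auto
          then have "\<ominus> a = ?h (\<ominus> k, \<ominus> u)" "(\<ominus> k, \<ominus> u) \<in> K \<times> V"
            using vR VR KR Kc subgrp(4)[OF Vsub] by (auto simp: minus_add l_minus)
          then show ?thesis by blast
        qed
        show "a \<oplus> b \<in> ?V" if "a \<in> ?V" "b \<in> ?V" for a b
        proof -
          from that obtain k u k' u' where "k \<in> K" "u \<in> V" "a = k \<otimes> v \<oplus> u"
            "k' \<in> K" "u' \<in> V" "b = k' \<otimes> v \<oplus> u'" by auto
          then have "a \<oplus> b = ?h (k \<oplus> k', u \<oplus> u')" "(k \<oplus> k', u \<oplus> u') \<in> K \<times> V"
            using vR VR KR Kc subgrp(3)[OF Vsub] by (auto simp: l_distr a_ac)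
          then show ?thesis by blast
        qed
      qed
      moreover have "c \<otimes> w \<in> ?V" if "c \<in> K" "w \<in> ?V" for c w
      proof -
        from that obtain k u where "k \<in> K" "u \<in> V" "w = k \<otimes> v \<oplus> u" by auto
        then have "c \<otimes> w = ?h (c \<otimes> k, c \<otimes> u)" "(c \<otimes> k, c \<otimes> u) \<in> K \<times> V"
          using that vR VR KR Kc VK by (auto simp: r_distr m_assoc)
        then show ?thesis by blast
      qed
      moreover have "?V \<subseteq> W"
        using VW v W(2) subgrp(3)[OF W(1)] by auto
      ultimately show ?thesis
        unfolding S_def using \<open>card ?V = card K ^ Suc m\<close> by blast
    qed
    ultimately have "card K ^ Suc m \<le> card V" using max by metis
    moreover have "card K \<ge> 2"
    proof -
      have "\<zero> \<noteq> \<one>" using div vR v subgrp(2)[OF Vsub] by force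
      moreover have "finite K" using Kc(1) fin finite_subset by blast
      ultimately show ?thesis
        using Kc(2,3) card_mono[of K "{\<zero>, \<one>}"] by simp
    qed
    ultimately show False using m by simp
  qed
  with VW m show ?thesis by (metis subset_antisym)
qed

text \<open>The cyclotomic value \<open>k\<close> divides the size of every noncentral conjugacy
  class, hence \<open>q^n - q\<close>; it also divides \<open>q^n - 1\<close>. So it divides the
  difference \<open>q - 1\<close>, which is smaller than \<open>\<bar>k\<bar>\<close> and
  nonzero.\<close>

theorem (in ring) finite_division_ring_commutative:
  assumes fin: "finite (carrier R)" and div: "Units R = carrier R - {\<zero>}"
    and x: "x \<in> carrier R" and y: "y \<in> carrier R"
  shows "x \<otimes> y = y \<otimes> x"
proof (rule ccontr)
  assume noncomm: "x \<otimes> y \<noteq> y \<otimes> x"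
  define Z where "Z = {z \<in> carrier R. \<forall>w\<in>carrier R. z \<otimes> w = w \<otimes> z}"
  define C where "C = (\<lambda>a. {z \<in> carrier R. z \<otimes> a = a \<otimes> z})"
  have one: "\<one> \<noteq> \<zero>" using div Units_one_closed by auto
  have mult_commutes: "h1 \<otimes> h2 \<otimes> a = a \<otimes> (h1 \<otimes> h2)"
    if "h1 \<otimes> a = a \<otimes> h1" "h2 \<otimes> a = a \<otimes> h2" "h1 \<in> carrier R" "h2 \<in> carrier R" "a \<in> carrier R"
    for h1 h2 a
    using that by (simp add: m_assoc) (simp add: m_assoc[symmetric])
  have subring_C: "subring (C a) R" if a: "a \<in> carrier R" for a
  proof (rule subringI)
    show "h1 \<otimes> h2 \<in> C a" if "h1 \<in> C a" "h2 \<in> C a" for h1 h2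
      using that a unfolding C_def by (auto intro: mult_commutes)
  qed (use a in \<open>auto simp: C_def l_minus r_minus l_distr r_distr\<close>)
  have subring_Z: "subring Z R"
  proof -
    have "Z = \<Inter>(C ` carrier R)" using one_closed unfolding Z_def C_def by blast
    then show ?thesis using subring_Inter[of "C ` carrier R"] subring_C by auto
  qed
  define q where "q = card Z"
  have finZ: "finite Z" using fin unfolding Z_def by simp
  have q: "q \<ge> 2"
    using subringE(2,3)[OF subring_Z] one card_mono[OF finZ, of "{\<zero>, \<one>}"] by (simp add: q_def)
  have sub_add: "subgroup K (add_monoid R)" if "subring K R" for K
    using that by (simp add: subring.axioms(1))
  obtain n where n: "card (carrier R) = q ^ n"
    using card_subspace_eq_power[OF fin div subring_Z add.subgroup_self] subringE(1)[OF subring_Z]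
    unfolding q_def by (metis m_closed subsetD)
  \<comment> \<open>The centralizer is a vector space over the centre \<open>Z\<close>, and the
    whole ring is one over the centralizer. Comparing exponents of \<open>q\<close> yields
    \<open>d dvd n\<close>.\<close>
  have card_C: "\<exists>d. d dvd n \<and> d < n \<and> d > 0 \<and> card (C a) = q ^ d" if a: "a \<in> carrier R - Z" for a
  proof -
    have aR: "a \<in> carrier R" using a by simp
    have "Z \<subseteq> C a" using aR by (auto simp: Z_def C_def)
    then obtain d where d: "card (C a) = q ^ d"
      using card_subspace_eq_power[OF fin div subring_Z sub_add[OF subring_C[OF aR]]]
        subringE(6)[OF subring_C[OF aR]] unfolding q_def by blast
    obtain m where "card (carrier R) = card (C a) ^ m"
      using card_subspace_eq_power[OF fin div subring_C[OF aR] add.subgroup_self]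
        subringE(1)[OF subring_C[OF aR]] by (metis m_closed subsetD)
    then have "q ^ n = q ^ (d * m)" using n d by (simp add: power_mult)
    then have "n = d * m" using q by simp
    moreover obtain w where "w \<in> carrier R" "w \<notin> C a" using a by (force simp: C_def Z_def)
    then have "C a \<subset> carrier R" by (auto simp: C_def)
    then have "card (C a) < card (carrier R)" using fin by (rule psubset_card_mono[rotated])
    then have "d < n" using n d q by simp
    moreover have "d > 0"
      using \<open>n = d * m\<close> \<open>d < n\<close> by (cases d) auto
    ultimately show ?thesis using d by (intro exI[of _ d]) simp
  qed
  have xZ: "x \<in> carrier R - Z" using noncomm x y by (auto simp: Z_def)
  obtain d0 where "d0 < n" "d0 > 0" using card_C[OF xZ] by blast
  then have n2: "n \<ge> 2" by simp
  obtain k :: int where k: "\<bar>k\<bar> > int q - 1"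
    and kdvd: "\<And>d. d dvd n \<Longrightarrow> d < n \<Longrightarrow> k * (int q ^ d - 1) dvd int q ^ n - 1"
    using cyclotomic_value_exists[OF n2 q] by blast
  define G where "G = units_of R"
  interpret G: group G unfolding G_def by (rule units_group)
  have cG: "carrier G = carrier R - {\<zero>}" unfolding G_def by (simp add: units_of_def div)
  have multG: "g \<otimes>\<^bsub>G\<^esub> h = g \<otimes> h" for g h by (simp add: G_def units_of_def)
  define \<phi> where "\<phi> = (\<lambda>g. \<lambda>h\<in>carrier G. g \<otimes>\<^bsub>G\<^esub> h \<otimes>\<^bsub>G\<^esub> inv\<^bsub>G\<^esub> g)"
  interpret A: group_action G "carrier G" \<phi>
    unfolding \<phi>_def by (rule G.action_by_conjugation)
  have orderG: "int (Coset.order G) = int q ^ n - 1"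
    unfolding Coset.order_def cG using n q fin by (simp add: of_nat_diff)
  have dvd_orbit: "nat \<bar>k\<bar> dvd card (orbit G \<phi> a)" if a: "a \<in> carrier R - Z" for a
  proof -
    have aG: "a \<in> carrier G" using a subringE(2)[OF subring_Z] by (auto simp: cG)
    have comm: "g \<otimes>\<^bsub>G\<^esub> a \<otimes>\<^bsub>G\<^esub> inv\<^bsub>G\<^esub> g = a \<longleftrightarrow> g \<otimes>\<^bsub>G\<^esub> a = a \<otimes>\<^bsub>G\<^esub> g" if "g \<in> carrier G" for g
      using that aG by (metis G.inv_solve_right' G.m_closed)
    \<comment> \<open>The stabilizer has \<open>q^d - 1\<close> elements, so the orbit has
      \<open>(q^n - 1) / (q^d - 1)\<close>, a quotient that \<open>k\<close> divides by its
      choice.\<close>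
    have "stabilizer G \<phi> a = C a - {\<zero>}"
      unfolding stabilizer_def \<phi>_def C_def using aG comm by (auto simp: cG multG)
    moreover obtain d where d: "d dvd n" "d < n" "d > 0" "card (C a) = q ^ d"
      using card_C[OF a] by blast
    moreover have "\<zero> \<in> C a" "finite (C a)" using fin a by (auto simp: C_def)
    ultimately have "int (card (stabilizer G \<phi> a)) = int q ^ d - 1"
      using q by (simp add: of_nat_diff)
    then have "int (card (orbit G \<phi> a)) * (int q ^ d - 1) = int q ^ n - 1"
      using A.orbit_stabilizer_theorem[OF aG] orderG by (metis of_nat_mult)
    then have "k * (int q ^ d - 1) dvd int (card (orbit G \<phi> a)) * (int q ^ d - 1)"
      using kdvd[OF d(1,2)] by simp
    moreover have "int q ^ d - 1 \<noteq> 0"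
      using one_less_power[of "int q" d] q d(3) by linarith
    ultimately have "k dvd int (card (orbit G \<phi> a))" by simp
    then show ?thesis by (simp add: nat_dvd_iff)
  qed
  have orbit_noncentral: "orbit G \<phi> a \<subseteq> carrier R - Z" if a: "a \<in> carrier R - Z" for a
  proof
    fix b assume b: "b \<in> orbit G \<phi> a"
    have aG: "a \<in> carrier G" using a subringE(2)[OF subring_Z] by (auto simp: cG)
    from b aG obtain g where g: "g \<in> carrier G" "b = g \<otimes>\<^bsub>G\<^esub> a \<otimes>\<^bsub>G\<^esub> inv\<^bsub>G\<^esub> g"
      by (auto simp: orbit_def \<phi>_def)
    have bG: "b \<in> carrier G" using g aG by simp
    have "b \<notin> Z"
    proof
      assume "b \<in> Z"
      then have "b \<otimes>\<^bsub>G\<^esub> g = g \<otimes>\<^bsub>G\<^esub> b" using g by (auto simp: Z_def multG cG)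
      moreover have "b \<otimes>\<^bsub>G\<^esub> g = g \<otimes>\<^bsub>G\<^esub> a" using g aG by (simp add: G.m_assoc)
      ultimately have "a = b" using g(1) aG bG by simp
      with \<open>b \<in> Z\<close> a show False by simp
    qed
    with bG show "b \<in> carrier R - Z" by (simp add: cG)
  qed
  let ?O = "orbit G \<phi> ` (carrier R - Z)"
  have aG: "a \<in> carrier G" if "a \<in> carrier R - Z" for a
    using that subringE(2)[OF subring_Z] by (auto simp: cG)
  have union: "\<Union>?O = carrier R - Z"
    using orbit_noncentral A.orbit_refl[OF aG] by blast
  have "nat \<bar>k\<bar> dvd card (\<Union>?O)"
  proof (rule dvd_partition)
    show "finite (\<Union>?O)" using union fin by simp
    show "\<forall>c\<in>?O. nat \<bar>k\<bar> dvd card c" using dvd_orbit by blast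
    have "?O \<subseteq> orbits G (carrier G) \<phi>" using aG by (auto simp: orbits_def)
    then show "\<forall>c1\<in>?O. \<forall>c2\<in>?O. c1 \<noteq> c2 \<longrightarrow> c1 \<inter> c2 = {}"
      using A.orbit_partition unfolding partition_def by (metis (no_types, lifting) disjoint_iff subsetD)
  qed
  then have "k dvd int (card (carrier R - Z))"
    unfolding union by (simp add: nat_dvd_iff)
  moreover have "Z \<subseteq> carrier R" by (auto simp: Z_def)
  then have "int (card (carrier R - Z)) = int q ^ n - int q"
    using n finZ fin card_mono[of "carrier R" Z] by (simp add: card_Diff_subset q_def of_nat_diff)
  moreover have "k dvd int q ^ n - 1"
    using kdvd[of 1] n2 by (auto dest: dvd_mult_left)
  ultimately have "k dvd (int q ^ n - 1) - (int q ^ n - int q)" by (metis dvd_diff)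
  then have "k dvd int q - 1" by simp
  then have "\<bar>k\<bar> \<le> int q - 1" using q dvd_imp_le_int[of "int q - 1" k] by simp
  with k show False by simp
qed

section \<open>Rings with small proper ideals and subrings\<close>

text \<open>Subtracting a chosen representative of its fibre sends each element into
  \<open>J\<close>; together with the value of \<open>h\<close> this is an injection into
  \<open>J \<times> T\<close>. As \<open>T\<close> is just a set, \<open>h\<close> can record how a
  ring element acts on an ideal.\<close>

lemma (in abelian_group) card_le_fibre_times_image:
  assumes "finite J" "finite T" "h ` carrier G \<subseteq> T"
    and fibre: "\<And>x y. x \<in> carrier G \<Longrightarrow> y \<in> carrier G \<Longrightarrow> h x = h y \<Longrightarrow> x \<ominus> y \<in> J"
  shows "card (carrier G) \<le> card J * card T"
proof -
  define rep where "rep = (\<lambda>t. SOME y. y \<in> carrier G \<and> h y = t)"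
  have rep: "rep (h x) \<in> carrier G \<and> h (rep (h x)) = h x" if "x \<in> carrier G" for x
    unfolding rep_def by (rule someI[of _ x]) (use that in simp)
  have "inj_on (\<lambda>x. (x \<ominus> rep (h x), h x)) (carrier G)"
  proof (rule inj_onI, clarify)
    fix x y assume xy: "x \<in> carrier G" "y \<in> carrier G" "h x = h y"
      and eq: "x \<ominus> rep (h x) = y \<ominus> rep (h y)"
    then show "x = y" using rep by (simp add: a_minus_def)
  qed
  moreover have "(\<lambda>x. (x \<ominus> rep (h x), h x)) ` carrier G \<subseteq> J \<times> T"
    using assms(3) rep fibre by (auto simp: image_subset_iff)
  ultimately show ?thesis
    using card_inj_on_le[of _ "carrier G" "J \<times> T"] assms by (simp add: card_cartesian_product)
qed

lemma (in ring) minus_mult_eq_zeroI: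
  assumes "x \<in> carrier R" "y \<in> carrier R" "a \<in> carrier R" "x \<otimes> a = y \<otimes> a"
  shows "(x \<ominus> y) \<otimes> a = \<zero>"
  using assms by (simp add: a_minus_def l_distr l_minus r_neg)

text \<open>The threshold \<open>B * B ^ B\<close> comes from letting the ring act on
  \<open>I\<close> by left multiplication. The kernel \<open>J\<close> is two-sided because
  \<open>I\<close> absorbs on the left, and proper because \<open>\<one>\<close> does not kill
  \<open>I\<close>; so it has at most \<open>B\<close> elements, while \<open>I\<close> has at most
  \<open>B ^ B\<close> self-maps.\<close>

lemma (in ring) simple_if_proper_ideals_bounded:
  assumes fin: "finite (carrier R)" and one: "\<one> \<noteq> \<zero>"
    and bound: "\<And>I. ideal I R \<Longrightarrow> I \<noteq> carrier R \<Longrightarrow> card I \<le> B"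
    and large: "card (carrier R) > B * B ^ B"
    and I: "ideal I R"
  shows "I = {\<zero>} \<or> I = carrier R"
proof (rule ccontr)
  assume "\<not> ?thesis"
  then have ne: "I \<noteq> {\<zero>}" "I \<noteq> carrier R" by auto
  interpret I: ideal I R by (rule I)
  have IR: "I \<subseteq> carrier R" by auto
  have finI: "finite I" using IR fin finite_subset by blast
  define J where "J = {r \<in> carrier R. \<forall>a\<in>I. r \<otimes> a = \<zero>}"
  have "ideal J R"
  proof (rule idealI[OF ring_axioms])
    show "subgroup J (add_monoid R)"
      by (rule add.subgroupI) (use IR in \<open>auto simp: J_def l_minus l_distr subset_iff\<close>)
    show "x \<otimes> a \<in> J" if "a \<in> J" "x \<in> carrier R" for a x
      using that IR by (auto simp: J_def m_assoc)
    show "a \<otimes> x \<in> J" if "a \<in> J" "x \<in> carrier R" for a x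
      using that IR I.I_l_closed by (auto simp: J_def m_assoc)
  qed
  moreover have "J \<noteq> carrier R"
  proof
    assume "J = carrier R"
    then have "\<one> \<in> J" by simp
    then have "I \<subseteq> {\<zero>}" using IR by (auto simp: J_def)
    with ne show False using I.zero_closed by blast
  qed
  ultimately have J: "card J \<le> B" by (rule bound)
  have "card (carrier R) \<le> card J * card (I \<rightarrow>\<^sub>E I)"
  proof (rule card_le_fibre_times_image)
    show "finite J" using fin by (simp add: J_def)
    show "finite (I \<rightarrow>\<^sub>E I)" using finI by (simp add: finite_PiE)
    show "(\<lambda>r. \<lambda>a\<in>I. r \<otimes> a) ` carrier R \<subseteq> I \<rightarrow>\<^sub>E I"
      using I.I_l_closed by auto
    show "x \<ominus> y \<in> J" if "x \<in> carrier R" "y \<in> carrier R" "(\<lambda>a\<in>I. x \<otimes> a) = (\<lambda>a\<in>I. y \<otimes> a)" for x y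
    proof -
      have "x \<otimes> a = y \<otimes> a" if "a \<in> I" for a
        using fun_cong[OF \<open>(\<lambda>a\<in>I. x \<otimes> a) = (\<lambda>a\<in>I. y \<otimes> a)\<close>, of a] that by simp
      then show ?thesis using that IR minus_mult_eq_zeroI by (auto simp: J_def)
    qed
  qed
  also have "card (I \<rightarrow>\<^sub>E I) = card I ^ card I"
    using finI by (simp add: card_PiE)
  also have "card J * card I ^ card I \<le> B * B ^ B"
  proof (rule mult_le_mono[OF J])
    have "card I \<le> B" using bound I ne by blast
    moreover have "card I > 0" using finI I.zero_closed by (metis card_gt_0_iff empty_iff)
    ultimately show "card I ^ card I \<le> B ^ B"
      using order_trans[OF power_mono[of "card I" B "card I"] power_increasing[of "card I" B B]] by simp
  qed
  finally have "card (carrier R) \<le> B * B ^ B" .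
  with large show False by simp
qed

text \<open>A left inverse \<open>r\<close> of \<open>y\<close> has a left inverse \<open>s\<close>
  in turn, and associativity forces \<open>s = y\<close>, so \<open>r\<close> is a two-sided
  inverse.\<close>

lemma (in ring) Units_eq_nonzero_if_left_invertible:
  assumes one: "\<one> \<noteq> \<zero>"
    and inv: "\<And>y. y \<in> carrier R \<Longrightarrow> y \<noteq> \<zero> \<Longrightarrow> \<exists>r\<in>carrier R. r \<otimes> y = \<one>"
  shows "Units R = carrier R - {\<zero>}"
proof (intro equalityI subsetI)
  fix y assume "y \<in> carrier R - {\<zero>}"
  then have y: "y \<in> carrier R" "y \<noteq> \<zero>" by auto
  obtain r where r: "r \<in> carrier R" "r \<otimes> y = \<one>" using inv y by blast
  then have "r \<noteq> \<zero>" using one y by auto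
  then obtain s where s: "s \<in> carrier R" "s \<otimes> r = \<one>" using inv r by blast
  have "s = s \<otimes> (r \<otimes> y)" using s r by simp
  also have "\<dots> = s \<otimes> r \<otimes> y" using s(1) r(1) y(1) by (rule m_assoc[symmetric])
  also have "\<dots> = y" using s y by simp
  finally show "y \<in> Units R" using r s y by (auto simp: Units_def)
next
  fix y assume "y \<in> Units R"
  then show "y \<in> carrier R - {\<zero>}" using one by (auto simp: Units_def)
qed

text \<open>Simple rings are prime: the elements \<open>y\<close> with \<open>f R y = 0\<close> form
  a two-sided ideal. If \<open>e\<close> lay in it, so would \<open>\<one>\<close>, and then
  \<open>f = 0\<close>.\<close>

lemma (in ring) simple_ring_corner_nonzero:
  assumes simple: "\<And>I. ideal I R \<Longrightarrow> I = {\<zero>} \<or> I = carrier R"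
    and ef: "e \<in> carrier R" "f \<in> carrier R" "e \<noteq> \<zero>" "f \<noteq> \<zero>"
  shows "\<exists>s\<in>carrier R. f \<otimes> s \<otimes> e \<noteq> \<zero>"
proof (rule ccontr)
  assume *: "\<not> ?thesis"
  define J where "J = {y \<in> carrier R. \<forall>s\<in>carrier R. f \<otimes> s \<otimes> y = \<zero>}"
  have "ideal J R"
  proof (rule idealI[OF ring_axioms])
    show "subgroup J (add_monoid R)"
      by (rule add.subgroupI) (use ef in \<open>auto simp: J_def r_minus r_distr\<close>)
    show "r \<otimes> a \<in> J" if "a \<in> J" "r \<in> carrier R" for a r
    proof -
      have "f \<otimes> s \<otimes> (r \<otimes> a) = f \<otimes> (s \<otimes> r) \<otimes> a" if "s \<in> carrier R" for s
        using that \<open>a \<in> J\<close> \<open>r \<in> carrier R\<close> ef by (simp add: J_def m_assoc)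
      then show ?thesis using that by (auto simp: J_def)
    qed
    show "a \<otimes> r \<in> J" if "a \<in> J" "r \<in> carrier R" for a r
      using that ef by (simp add: J_def m_assoc[symmetric])
  qed
  moreover have "e \<in> J" using * ef by (auto simp: J_def)
  ultimately have "\<one> \<in> J" using simple ef by blast
  then have "f \<otimes> \<one> \<otimes> \<one> = \<zero>" unfolding J_def by blast
  then show False using ef by simp
qed

text \<open>Brauer's lemma, applied to a left ideal \<open>R x\<close> of least cardinality with
  \<open>x\<close> nonzero. The last conclusion is the minimality of \<open>R e\<close>: each of its
  nonzero elements generates it.\<close>

lemma (in ring) simple_ring_minimal_idempotent:
  assumes fin: "finite (carrier R)" and one: "\<one> \<noteq> \<zero>"
    and simple: "\<And>I. ideal I R \<Longrightarrow> I = {\<zero>} \<or> I = carrier R"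
    and nondiv: "Units R \<noteq> carrier R - {\<zero>}"
  obtains e where "e \<in> carrier R" "e \<otimes> e = e" "e \<noteq> \<zero>" "e \<noteq> \<one>"
    and "\<And>y. y \<in> carrier R \<Longrightarrow> y \<otimes> e = y \<Longrightarrow> y \<noteq> \<zero> \<Longrightarrow> \<exists>r\<in>carrier R. r \<otimes> y = e"
proof -
  define L where "L = (\<lambda>y. (\<lambda>r. r \<otimes> y) ` carrier R)"
  have finL: "finite (L y)" for y using fin by (simp add: L_def)
  have self: "y \<in> L y" if "y \<in> carrier R" for y
    unfolding L_def using that by (intro image_eqI[of _ _ \<one>]) auto
  have L_mono: "L y \<subseteq> L x" if "x \<in> carrier R" "y \<in> L x" for x y
    using that by (auto simp: L_def m_assoc[symmetric])
  have LR: "L y \<subseteq> carrier R" if "y \<in> carrier R" for y using that by (auto simp: L_def)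
  obtain x where x: "x \<in> carrier R" "x \<noteq> \<zero>"
    and min: "\<And>y. y \<in> carrier R \<Longrightarrow> y \<noteq> \<zero> \<Longrightarrow> card (L x) \<le> card (L y)"
    using ex_has_least_nat[of "\<lambda>x. x \<in> carrier R \<and> x \<noteq> \<zero>" \<one> "\<lambda>x. card (L x)"] one by auto
  have L_eq: "L y = L x" if "y \<in> L x" "y \<noteq> \<zero>" for y
    using card_seteq[OF finL L_mono[OF x(1) that(1)]] min that LR[OF x(1)] by blast
  have "\<exists>s\<in>carrier R. x \<otimes> s \<otimes> x \<noteq> \<zero>"
    by (rule simple_ring_corner_nonzero[OF simple x(1) x(1) x(2) x(2)])
  then obtain s where s: "s \<in> carrier R" "x \<otimes> s \<otimes> x \<noteq> \<zero>" by blast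
  define z where "z = s \<otimes> x"
  have z: "z \<in> L x" "z \<in> carrier R" "x \<otimes> z \<noteq> \<zero>"
    using s x by (auto simp: L_def z_def m_assoc)
  \<comment> \<open>By minimality, right multiplication by \<open>z\<close> maps \<open>R x\<close>
    onto itself, hence bijectively by finiteness. A preimage \<open>e\<close> of \<open>z\<close>
    satisfies \<open>e e z = e z\<close>, and cancelling \<open>z\<close> gives idempotency.\<close>
  have image: "(\<lambda>y. y \<otimes> z) ` L x = L x"
  proof -
    have "(\<lambda>y. y \<otimes> z) ` L x = L (x \<otimes> z)"
      using x z by (auto simp: L_def image_image m_assoc)
    moreover have "x \<otimes> z \<in> L x"
      using z x L_mono[OF x(1) z(1)] by (auto simp: L_def)
    ultimately show ?thesis using L_eq z by blast
  qed
  then have inj: "inj_on (\<lambda>y. y \<otimes> z) (L x)"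
    using finL by (simp add: finite_surj_inj)
  from image z(1) obtain e where e: "e \<in> L x" "z = e \<otimes> z" by (metis imageE)
  have eR: "e \<in> carrier R" using e LR x by blast
  have "e \<otimes> e \<in> L x"
    using L_mono[OF x(1) e(1)] eR by (auto simp: L_def)
  moreover have "e \<otimes> e \<otimes> z = e \<otimes> z" using e(2) eR z(2) by (simp add: m_assoc)
  ultimately have ee: "e \<otimes> e = e" using inj_onD[OF inj _ _ e(1)] by blast
  have e0: "e \<noteq> \<zero>" using e z x by auto
  have Le: "L e = L x" using L_eq e e0 by blast
  \<comment> \<open>If \<open>e\<close> were \<open>\<one>\<close>, the ring itself would be a
    minimal left ideal, every nonzero element would be left invertible, and the ring would be a
    division ring.\<close>
  have "e \<noteq> \<one>"
  proof
    assume "e = \<one>"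
    then have "L x = carrier R" using Le by (auto simp: L_def)
    have "\<exists>r\<in>carrier R. r \<otimes> y = \<one>" if "y \<in> carrier R" "y \<noteq> \<zero>" for y
    proof -
      have "L y = carrier R"
        using card_seteq[OF fin LR] min that \<open>L x = carrier R\<close> by metis
      then show ?thesis unfolding L_def by (metis imageE one_closed)
    qed
    then show False using Units_eq_nonzero_if_left_invertible[OF one] nondiv by blast
  qed
  moreover have "\<exists>r\<in>carrier R. r \<otimes> y = e" if "y \<in> carrier R" "y \<otimes> e = y" "y \<noteq> \<zero>" for y
  proof -
    have "y \<in> L x" using that Le by (metis L_def image_eqI)
    then have "e \<in> L y" using L_eq that e by blast
    then show ?thesis by (auto simp: L_def)
  qed
  ultimately show ?thesis using that eR ee e0 by blast
qed

text \<open>For complementary idempotents this is a component of the Peirce decomposition, that is,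
  one block of a block matrix.\<close>

definition peirce_corner :: "('a, 'b) ring_scheme \<Rightarrow> 'a \<Rightarrow> 'a \<Rightarrow> 'a set" where
  "peirce_corner R f e = (\<lambda>x. f \<otimes>\<^bsub>R\<^esub> x \<otimes>\<^bsub>R\<^esub> e) ` carrier R"

text \<open>Because \<open>e \<oplus> f = \<one>\<close>, the identity
  \<open>f (x y) e = (f x e) y e + f x (f y e)\<close> makes the kernel \<open>A\<close> of the map
  from \<open>x\<close> to \<open>f x e\<close> multiplicatively closed, and \<open>f e = 0\<close>
  puts \<open>\<one>\<close> into it. Kernel and image together account for the whole ring, so a
  small kernel forces a large corner.\<close>

lemma (in ring) card_le_corner_square:
  assumes fin: "finite (carrier R)"
    and bound: "\<And>A. subring A R \<Longrightarrow> A \<noteq> carrier R \<Longrightarrow> (card A)\<^sup>2 \<le> B * card (carrier R)"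
    and ef: "e \<in> carrier R" "f \<in> carrier R" "e \<oplus> f = \<one>" "f \<otimes> e = \<zero>"
    and nonzero: "\<exists>s\<in>carrier R. f \<otimes> s \<otimes> e \<noteq> \<zero>"
  shows "card (carrier R) \<le> B * (card (peirce_corner R f e))\<^sup>2"
proof -
  define A where "A = {x \<in> carrier R. f \<otimes> x \<otimes> e = \<zero>}"
  have "subring A R"
  proof (rule subringI)
    show "x \<otimes> y \<in> A" if "x \<in> A" "y \<in> A" for x y
    proof -
      have xy: "x \<in> carrier R" "y \<in> carrier R" "f \<otimes> x \<otimes> e = \<zero>" "f \<otimes> y \<otimes> e = \<zero>"
        using that by (auto simp: A_def)
      have "f \<otimes> (x \<otimes> y) \<otimes> e = f \<otimes> x \<otimes> (e \<oplus> f) \<otimes> y \<otimes> e"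
        using xy ef by (simp add: m_assoc)
      also have "\<dots> = (f \<otimes> x \<otimes> e) \<otimes> (y \<otimes> e) \<oplus> (f \<otimes> x) \<otimes> (f \<otimes> y \<otimes> e)"
        using xy(1,2) ef(1,2) by (simp add: r_distr l_distr m_assoc)
      also have "\<dots> = \<zero>" using xy ef by simp
      finally show ?thesis using xy by (simp add: A_def)
    qed
  qed (use ef in \<open>auto simp: A_def l_minus r_minus l_distr r_distr\<close>)
  moreover have "A \<noteq> carrier R" using nonzero by (auto simp: A_def)
  ultimately have A: "(card A)\<^sup>2 \<le> B * card (carrier R)" by (rule bound)
  let ?N = "card (carrier R)" and ?c = "card (peirce_corner R f e)"
  have "?N \<le> card A * ?c"
  proof (rule card_le_fibre_times_image)
    show "finite A" "finite (peirce_corner R f e)"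
      using fin by (auto simp: A_def peirce_corner_def)
    show "(\<lambda>x. f \<otimes> x \<otimes> e) ` carrier R \<subseteq> peirce_corner R f e"
      by (simp add: peirce_corner_def)
    show "x \<ominus> y \<in> A" if "x \<in> carrier R" "y \<in> carrier R" "f \<otimes> x \<otimes> e = f \<otimes> y \<otimes> e" for x y
      using that ef by (simp add: A_def a_minus_def l_minus r_minus l_distr r_distr r_neg)
  qed
  then have "?N\<^sup>2 \<le> (card A)\<^sup>2 * ?c\<^sup>2"
    by (metis power_mono power_mult_distrib zero_le)
  also have "\<dots> \<le> (B * ?N) * ?c\<^sup>2" using A by (rule mult_le_mono1)
  finally have "?N * ?N \<le> ?N * (B * ?c\<^sup>2)" by (simp add: power2_eq_square mult_ac)
  moreover have "?N > 0" using fin by (auto simp: card_gt_0_iff)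
  ultimately show ?thesis by simp
qed

text \<open>Write \<open>a\<close>, \<open>b\<close>, \<open>c\<close> for the sizes of
  \<open>f R e\<close>, \<open>e R f\<close>, \<open>f R f\<close>. The two triangular subrings give
  \<open>N \<le> B a^2\<close> and \<open>N \<le> B b^2\<close>, hence \<open>N \<le> B a b\<close>,
  whereas these three corners are independent, so \<open>c b a \<le> N\<close>. Thus
  \<open>c \<le> B\<close>; minimality of \<open>R e\<close> gives \<open>a \<le> c\<close>, and
  \<open>N \<le> B^3\<close> contradicts the second size assumption.\<close>

theorem (in ring) field_if_proper_ideals_and_subrings_small:
  assumes fin: "finite (carrier R)" and one: "\<one> \<noteq> \<zero>"
    and ideals: "\<And>I. ideal I R \<Longrightarrow> I \<noteq> carrier R \<Longrightarrow> card I \<le> B"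
    and subrings: "\<And>A. subring A R \<Longrightarrow> A \<noteq> carrier R \<Longrightarrow> (card A)\<^sup>2 \<le> B * card (carrier R)"
    and large: "card (carrier R) > B * B ^ B" "card (carrier R) > B ^ 3"
  shows "field R"
proof -
  note simple = simple_if_proper_ideals_bounded[OF fin one ideals large(1)]
  have div: "Units R = carrier R - {\<zero>}"
  proof (rule ccontr)
    assume "Units R \<noteq> carrier R - {\<zero>}"
    then obtain e where e: "e \<in> carrier R" "e \<otimes> e = e" "e \<noteq> \<zero>" "e \<noteq> \<one>"
      and minimal: "\<And>y. y \<in> carrier R \<Longrightarrow> y \<otimes> e = y \<Longrightarrow> y \<noteq> \<zero> \<Longrightarrow> \<exists>r\<in>carrier R. r \<otimes> y = e"
      using simple_ring_minimal_idempotent[OF fin one simple] by blast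
    define f where "f = \<one> \<ominus> e"
    have f: "f \<in> carrier R" "f \<noteq> \<zero>" using e by (auto simp: f_def r_right_minus_eq)
    have sum: "e \<oplus> f = \<one>"
      using e by (simp add: f_def a_minus_def a_comm[of \<one>] r_neg2)
    then have sum': "f \<oplus> e = \<one>" using e f by (simp add: a_comm)
    have orth: "e \<otimes> f = \<zero>" "f \<otimes> e = \<zero>"
      using e by (auto simp: f_def a_minus_def r_distr l_distr r_minus l_minus r_neg)
    have "f \<otimes> f = f \<otimes> (f \<oplus> e)" using e f orth by (subst r_distr) auto
    then have ff: "f \<otimes> f = f" using sum' f by simp
    let ?N = "card (carrier R)"
    define a where "a = card (peirce_corner R f e)"
    define b where "b = card (peirce_corner R e f)"
    define c where "c = card (peirce_corner R f f)"
    obtain s where s: "s \<in> carrier R" "f \<otimes> s \<otimes> e \<noteq> \<zero>"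
      using simple_ring_corner_nonzero[OF simple e(1) f(1) e(3) f(2)] by blast
    have Na: "?N \<le> B * a\<^sup>2"
      unfolding a_def using s by (intro card_le_corner_square fin subrings e f sum sum' orth) auto
    have Nb: "?N \<le> B * b\<^sup>2"
      unfolding b_def using simple_ring_corner_nonzero[OF simple f(1) e(1) f(2) e(3)]
      by (intro card_le_corner_square fin subrings e f sum sum' orth) auto
    have fin_corner: "finite (peirce_corner R u v)" for u v
      using fin by (simp add: peirce_corner_def)
    \<comment> \<open>By minimality every element of \<open>fRe\<close> is an \<open>fRf\<close>-multiple of any nonzero \<open>y\<close> in \<open>fRe\<close>.\<close>
    have "a \<le> c"
    proof -
      define y where "y = f \<otimes> s \<otimes> e"
      have y: "y \<in> carrier R" "y \<otimes> e = y" "f \<otimes> y = y" "y \<noteq> \<zero>"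
        using s e f ff by (auto simp: y_def m_assoc) (simp add: m_assoc[symmetric])
      obtain r where r: "r \<in> carrier R" "r \<otimes> y = e" using minimal y by blast
      have "peirce_corner R f e \<subseteq> (\<lambda>u. u \<otimes> y) ` peirce_corner R f f"
      proof
        fix w assume "w \<in> peirce_corner R f e"
        then obtain x where x: "x \<in> carrier R" "w = f \<otimes> x \<otimes> e" by (auto simp: peirce_corner_def)
        have "w = (f \<otimes> (x \<otimes> r) \<otimes> f) \<otimes> y"
          using x r y f e by (simp add: m_assoc)
        moreover have "f \<otimes> (x \<otimes> r) \<otimes> f \<in> peirce_corner R f f"
          using x r by (simp add: peirce_corner_def)
        ultimately show "w \<in> (\<lambda>u. u \<otimes> y) ` peirce_corner R f f" by (rule image_eqI)
      qed
      then show ?thesis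
        unfolding a_def c_def by (rule surj_card_le[OF fin_corner])
    qed
    have "c * b * a \<le> ?N"
    proof -
      \<comment> \<open>Multiplying the sum by the idempotents from both sides recovers each
        summand, so addition is injective on triples from the three corners.\<close>
      have comp: "f \<otimes> (u \<oplus> v \<oplus> w) \<otimes> f = u \<and> e \<otimes> (u \<oplus> v \<oplus> w) \<otimes> f = v \<and> f \<otimes> (u \<oplus> v \<oplus> w) \<otimes> e = w
          \<and> u \<oplus> v \<oplus> w \<in> carrier R"
        if uvw: "u \<in> peirce_corner R f f" "v \<in> peirce_corner R e f" "w \<in> peirce_corner R f e" for u v w
      proof -
        from uvw obtain x y z where xyz: "x \<in> carrier R" "y \<in> carrier R" "z \<in> carrier R"
          "u = f \<otimes> x \<otimes> f" "v = e \<otimes> y \<otimes> f" "w = f \<otimes> z \<otimes> e" by (auto simp: peirce_corner_def)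
        have left: "f \<otimes> (f \<otimes> t) = f \<otimes> t" "f \<otimes> (e \<otimes> t) = \<zero>" "e \<otimes> (f \<otimes> t) = \<zero>" "e \<otimes> (e \<otimes> t) = e \<otimes> t"
          if "t \<in> carrier R" for t
          using that e f ff orth by (simp_all add: m_assoc[symmetric])
        show ?thesis
          using xyz e f ff orth left by (simp add: l_distr r_distr m_assoc)
      qed
      have "inj_on (\<lambda>(u, v, w). u \<oplus> v \<oplus> w)
          (peirce_corner R f f \<times> peirce_corner R e f \<times> peirce_corner R f e)"
      proof (rule inj_onI)
        fix p p' assume p: "p \<in> peirce_corner R f f \<times> peirce_corner R e f \<times> peirce_corner R f e"
          and p': "p' \<in> peirce_corner R f f \<times> peirce_corner R e f \<times> peirce_corner R f e"
          and eq: "(\<lambda>(u, v, w). u \<oplus> v \<oplus> w) p = (\<lambda>(u, v, w). u \<oplus> v \<oplus> w) p'"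
        obtain u v w u' v' w' where [simp]: "p = (u, v, w)" "p' = (u', v', w')" by (metis surj_pair)
        have eq': "u \<oplus> v \<oplus> w = u' \<oplus> v' \<oplus> w'" using eq by simp
        have m: "u \<in> peirce_corner R f f" "v \<in> peirce_corner R e f" "w \<in> peirce_corner R f e"
          using p by simp_all
        have m': "u' \<in> peirce_corner R f f" "v' \<in> peirce_corner R e f" "w' \<in> peirce_corner R f e"
          using p' by simp_all
        show "p = p'" using comp[OF m] comp[OF m'] unfolding eq' by simp
      qed
      moreover have "(\<lambda>(u, v, w). u \<oplus> v \<oplus> w) `
          (peirce_corner R f f \<times> peirce_corner R e f \<times> peirce_corner R f e) \<subseteq> carrier R"
        using comp by auto
      ultimately have "card (peirce_corner R f f \<times> peirce_corner R e f \<times> peirce_corner R f e) \<le> ?N"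
        using fin by (rule card_inj_on_le)
      then show ?thesis
        by (simp add: a_def b_def c_def card_cartesian_product mult.assoc)
    qed
    have "?N\<^sup>2 \<le> (B * a\<^sup>2) * (B * b\<^sup>2)"
      unfolding power2_eq_square[of ?N] by (rule mult_le_mono[OF Na Nb])
    then have "?N\<^sup>2 \<le> (B * (b * a))\<^sup>2" by (simp add: power2_eq_square mult_ac)
    then have "?N \<le> B * (b * a)" by (simp add: power2_nat_le_eq_le)
    with \<open>c * b * a \<le> ?N\<close> have "c * (b * a) \<le> B * (b * a)" by (metis le_trans mult.assoc)
    moreover have "b * a > 0"
      using fin_corner unfolding a_def b_def by (auto simp: card_gt_0_iff peirce_corner_def)
    ultimately have "c \<le> B" by simp
    then have "a\<^sup>2 \<le> B\<^sup>2" using \<open>a \<le> c\<close> by (simp add: power_mono)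
    then have "?N \<le> B * B\<^sup>2" using Na mult_le_mono2[of "a\<^sup>2" "B\<^sup>2" B] by linarith
    with large(2) show False by (simp add: power3_eq_cube power2_eq_square)
  qed
  have "cring R"
    by (intro cring.intro ring_axioms comm_monoid.intro monoid_axioms comm_monoid_axioms.intro
        finite_division_ring_commutative[OF fin div])
  then show ?thesis using div by (rule cring.cring_fieldI)
qed

section \<open>Characters of finite abelian groups\<close>

lemma hom_circle_group_iff:
  "\<psi> \<in> hom G circle_group \<longleftrightarrow> (\<forall>x\<in>carrier G. cmod (\<psi> x) = 1) \<and>
     (\<forall>x\<in>carrier G. \<forall>y\<in>carrier G. \<psi> (x \<otimes>\<^bsub>G\<^esub> y) = \<psi> x * \<psi> y)"
  by (auto simp: hom_def circle_group_def Pi_iff)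

lemma (in group) hom_circle_group_one:
  assumes "\<psi> \<in> hom G circle_group"
  shows "\<psi> \<one> = 1"
proof -
  have "\<psi> \<one> * \<psi> \<one> = \<psi> \<one>" "\<psi> \<one> \<noteq> 0"
    using assms unfolding hom_circle_group_iff
    by (metis one_closed l_one, metis one_closed norm_zero zero_neq_one)
  then show ?thesis by simp
qed

lemma (in group) hom_circle_group_pow:
  assumes "\<psi> \<in> hom G circle_group" "x \<in> carrier G"
  shows "\<psi> (x [^] (n::nat)) = \<psi> x ^ n"
  using assms hom_circle_group_one
  by (induction n) (auto simp: hom_circle_group_iff)

lemma (in group) hom_circle_group_inv:
  assumes "\<psi> \<in> hom G circle_group" "x \<in> carrier G"
  shows "\<psi> (inv x) = cnj (\<psi> x)"
proof -
  have "\<psi> x * \<psi> (inv x) = 1"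
    using assms hom_circle_group_one[OF assms(1)] r_inv[OF assms(2)] inv_closed[OF assms(2)]
    unfolding hom_circle_group_iff by metis
  moreover have "\<psi> x * cnj (\<psi> x) = 1" "\<psi> x \<noteq> 0"
    using assms by (auto simp: hom_circle_group_iff complex_norm_square[symmetric])
  ultimately show ?thesis by (metis mult_left_cancel)
qed

text \<open>\<open>m\<close> is the order of \<open>y\<close> modulo \<open>K\<close>; division with
  remainder by \<open>m\<close>.\<close>

lemma (in group) pow_dvd_of_mem:
  assumes K: "subgroup K G" and y: "y \<in> carrier G"
    and m: "m > 0" "y [^] m \<in> K" "\<forall>j. 0 < j \<and> j < m \<longrightarrow> y [^] j \<notin> K"
    and j: "y [^] (j::nat) \<in> K"
  shows "m dvd j"
proof -
  interpret K: subgroup K G by (rule K)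
  have pow: "(y [^] m) [^] n \<in> K" for n :: nat
    by (induction n) (use m(2) in auto)
  have "y [^] j = (y [^] m) [^] (j div m) \<otimes> y [^] (j mod m)"
    using y by (simp add: nat_pow_pow nat_pow_mult)
  then have "y [^] (j mod m) = inv ((y [^] m) [^] (j div m)) \<otimes> y [^] j"
    using y by (simp add: inv_solve_left)
  then have "y [^] (j mod m) \<in> K"
    using pow j by simp
  with m(3) m(1) show ?thesis by (auto simp: dvd_eq_mod_eq_0)
qed

text \<open>On the subgroup generated by \<open>K\<close> and \<open>y\<close> the extension sends
  \<open>k y^j\<close> to \<open>\<chi> k * z^j\<close>. It is well defined because
  \<open>y^j\<close> lies in \<open>K\<close> only for multiples \<open>j\<close> of
  \<open>m\<close>, where the choice of \<open>z\<close> makes both prescriptions agree. Leaving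
  \<open>z\<close> an arbitrary \<open>m\<close>-th root is what later permits a nontrivial value at
  \<open>y\<close>.\<close>

lemma (in comm_group) extend_character_step:
  assumes fin: "finite (carrier G)" and K: "subgroup K G"
    and \<chi>: "\<chi> \<in> hom (G\<lparr>carrier := K\<rparr>) circle_group" and y: "y \<in> carrier G"
    and m: "m > 0" "y [^] m \<in> K" "\<forall>j. 0 < j \<and> j < m \<longrightarrow> y [^] j \<notin> K"
    and z: "z ^ m = \<chi> (y [^] m)"
  obtains K' \<chi>' where "subgroup K' G" "K \<subseteq> K'" "y \<in> K'" "\<chi>' \<in> hom (G\<lparr>carrier := K'\<rparr>) circle_group"
    "\<And>k. k \<in> K \<Longrightarrow> \<chi>' k = \<chi> k" "\<chi>' y = z"
proof -
  interpret K: subgroup K G by (rule K)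
  interpret GK: group "G\<lparr>carrier := K\<rparr>" by (rule subgroup_imp_group[OF K])
  have \<chi>_mult: "\<chi> (a \<otimes> b) = \<chi> a * \<chi> b" and \<chi>_norm: "cmod (\<chi> a) = 1" if "a \<in> K" "b \<in> K" for a b
    using \<chi> that by (auto simp: hom_circle_group_iff)
  have \<chi>_pow: "\<chi> (y [^] j) = z ^ j" if j: "y [^] j \<in> K" for j :: nat
  proof -
    obtain i where i: "j = m * i" using pow_dvd_of_mem[OF K y m j] by blast
    have "\<chi> ((y [^] m) [^] i) = \<chi> (y [^] m) ^ i"
      using GK.hom_circle_group_pow[OF \<chi>, of "y [^] m" i] m(2) by (simp add: nat_pow_consistent[symmetric])
    then show ?thesis using y z by (simp add: i nat_pow_pow power_mult)
  qed
  have "cmod z ^ m = 1" using z \<chi>_norm m(2) by (metis norm_power)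
  then have z_norm: "cmod z = 1" using m(1) power_eq_imp_eq_base[of "cmod z" m 1] by simp
  then have z0: "z \<noteq> 0" by auto
  \<comment> \<open>Ordering the exponents keeps \<open>j' - j\<close> a genuine natural number; the
    other order follows by symmetry.\<close>
  have wd_le: "\<chi> k * z ^ j = \<chi> k' * z ^ j'"
    if "k \<in> K" "k' \<in> K" "k \<otimes> y [^] j = k' \<otimes> y [^] j'" "j \<le> j'" for k k' and j j' :: nat
  proof -
    have "k \<otimes> y [^] j = (k' \<otimes> y [^] (j' - j)) \<otimes> y [^] j"
      using that y K.subset by (simp add: m_assoc nat_pow_mult)
    then have k: "k = k' \<otimes> y [^] (j' - j)" using that y by simp
    then have "y [^] (j' - j) = inv k' \<otimes> k" using that y by (simp add: inv_solve_left)
    then have yK: "y [^] (j' - j) \<in> K" using that by simp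
    then have "\<chi> k = \<chi> k' * z ^ (j' - j)" using \<chi>_mult[OF that(2) yK] \<chi>_pow k by simp
    then show ?thesis using that(4) by (simp add: power_add[symmetric])
  qed
  have wd: "\<chi> k * z ^ j = \<chi> k' * z ^ j'"
    if "k \<in> K" "k' \<in> K" "k \<otimes> y [^] j = k' \<otimes> y [^] j'" for k k' and j j' :: nat
    using wd_le[of k k' j j'] wd_le[of k' k j' j] that by (cases "j \<le> j'") auto
  define K' where "K' = (\<lambda>(k, j). k \<otimes> y [^] (j::nat)) ` (K \<times> UNIV)"
  define \<chi>' where "\<chi>' = (\<lambda>g. SOME c. \<exists>k j. k \<in> K \<and> g = k \<otimes> y [^] (j::nat) \<and> c = \<chi> k * z ^ j)"
  have \<chi>'_eq: "\<chi>' (k \<otimes> y [^] j) = \<chi> k * z ^ j" if "k \<in> K" for k and j :: nat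
    unfolding \<chi>'_def
  proof (rule some_equality)
    fix c assume "\<exists>k' j'. k' \<in> K \<and> k \<otimes> y [^] j = k' \<otimes> y [^] (j'::nat) \<and> c = \<chi> k' * z ^ j'"
    then show "c = \<chi> k * z ^ j" using wd that by metis
  qed (use that in blast)
  have K'I: "k \<otimes> y [^] j \<in> K'" if "k \<in> K" for k and j :: nat
    unfolding K'_def using that by force
  have K'E: "\<exists>k\<in>K. \<exists>j::nat. g = k \<otimes> y [^] j" if "g \<in> K'" for g
    using that unfolding K'_def by auto
  have prod: "(k \<otimes> y [^] i) \<otimes> (l \<otimes> y [^] j) = (k \<otimes> l) \<otimes> y [^] (i + j)"
    if "k \<in> K" "l \<in> K" for k l and i j :: nat
  proof -
    have "k \<in> carrier G" "l \<in> carrier G" using that by auto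
    then show ?thesis unfolding nat_pow_mult[OF y, symmetric] using y by (simp add: m_ac)
  qed
  have "subgroup K' G"
  proof (rule subgroupI)
    show "K' \<subseteq> carrier G" using y unfolding K'_def by auto
    show "K' \<noteq> {}" using K'I[OF K.one_closed] by blast
    show "a \<otimes> b \<in> K'" if ab: "a \<in> K'" "b \<in> K'" for a b
    proof -
      obtain k i where "k \<in> K" "a = k \<otimes> y [^] (i::nat)" using K'E[OF ab(1)] by blast
      moreover obtain l j where "l \<in> K" "b = l \<otimes> y [^] (j::nat)" using K'E[OF ab(2)] by blast
      ultimately show ?thesis using prod K'I by simp
    qed
    show "inv a \<in> K'" if aK': "a \<in> K'" for a
    proof -
      obtain k and i :: nat where a: "k \<in> K" "a = k \<otimes> y [^] i"
        using K'E[OF aK'] by blast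
      \<comment> \<open>Elements of \<open>K'\<close> carry natural exponents, so inverses rely on
        finiteness: \<open>y^i\<close> is inverted by its power with exponent
        \<open>card (carrier G) - 1\<close>.\<close>
      have "i + i * (Coset.order G - 1) = Coset.order G * i"
        using fin order_gt_0_iff_finite by (cases "Coset.order G") auto
      then have "y [^] i \<otimes> y [^] (i * (Coset.order G - 1)) = (y [^] Coset.order G) [^] i"
        using y by (simp add: nat_pow_mult nat_pow_pow)
      then have "y [^] i \<otimes> y [^] (i * (Coset.order G - 1)) = \<one>"
        using y by (simp add: pow_order_eq_1)
      then have "inv (y [^] i) = y [^] (i * (Coset.order G - 1))"
        using y by (metis inv_unique' nat_pow_closed m_comm)
      then have "inv a = inv k \<otimes> y [^] (i * (Coset.order G - 1))"
        using a y by (simp add: inv_mult)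
      then show ?thesis using a K'I by simp
    qed
  qed
  moreover have "K \<subseteq> K'"
    using K'I[of _ 0] by auto
  moreover have "y \<in> K'"
    using K'I[OF K.one_closed, of 1] y by simp
  moreover have "\<chi>' \<in> hom (G\<lparr>carrier := K'\<rparr>) circle_group"
    unfolding hom_circle_group_iff
  proof (intro conjI ballI)
    fix a assume "a \<in> carrier (G\<lparr>carrier := K'\<rparr>)"
    then have "a \<in> K'" by simp
    then obtain k i where a: "k \<in> K" "a = k \<otimes> y [^] (i::nat)" using K'E by blast
    then show "cmod (\<chi>' a) = 1" using \<chi>'_eq \<chi>_norm z_norm by (simp add: norm_mult norm_power)
    fix b assume "b \<in> carrier (G\<lparr>carrier := K'\<rparr>)"
    then have "b \<in> K'" by simp
    then obtain l j where b: "l \<in> K" "b = l \<otimes> y [^] (j::nat)" using K'E by blast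
    show "\<chi>' (a \<otimes>\<^bsub>G\<lparr>carrier := K'\<rparr>\<^esub> b) = \<chi>' a * \<chi>' b"
      using a b prod \<chi>'_eq \<chi>_mult by (simp add: power_add)
  qed
  moreover have "\<chi>' k = \<chi> k" if "k \<in> K" for k
    using \<chi>'_eq[OF that, of 0] that by simp
  moreover have "\<chi>' y = z"
  proof -
    have "\<chi> \<one> = 1" using GK.hom_circle_group_one[OF \<chi>] by simp
    then show ?thesis using \<chi>'_eq[OF K.one_closed, of 1] y by simp
  qed
  ultimately show ?thesis by (rule that)
qed

lemma (in group) least_power_in_subgroup:
  assumes "finite (carrier G)" "subgroup K G" "y \<in> carrier G"
  obtains m :: nat where "m > 0" "y [^] m \<in> K" "\<forall>j. 0 < j \<and> j < m \<longrightarrow> y [^] j \<notin> K"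
proof -
  define P where "P = (\<lambda>m::nat. 0 < m \<and> y [^] m \<in> K)"
  have "P (Coset.order G)"
    using assms pow_order_eq_1[of y] subgroup.one_closed[of K G] by (auto simp: P_def order_gt_0_iff_finite)
  then have "P (Least P)" by (rule LeastI)
  moreover have "\<not> P j" if "j < Least P" for j using that by (rule not_less_Least)
  ultimately show ?thesis by (intro that[of "Least P"]) (auto simp: P_def)
qed

lemma unit_complex_root_exists:
  assumes "cmod c = 1" "m > 0"
  shows "\<exists>z. z ^ m = c"
proof
  have "c \<noteq> 0" using assms(1) by auto
  then have "cis (Arg c) = c" using assms(1) cis_Arg[of c] by (simp add: sgn_eq)
  then show "cis (Arg c / real m) ^ m = c" using assms by (simp add: DeMoivre)
qed

text \<open>Elements outside \<open>K\<close> are adjoined one at a time; the required root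
  \<open>z\<close> exists because the circle group is divisible.\<close>

lemma (in comm_group) extend_character:
  assumes fin: "finite (carrier G)"
  shows "subgroup K G \<Longrightarrow> \<chi> \<in> hom (G\<lparr>carrier := K\<rparr>) circle_group \<Longrightarrow>
    \<exists>\<psi>\<in>hom G circle_group. \<forall>k\<in>K. \<psi> k = \<chi> k"
proof (induction "card (carrier G - K)" arbitrary: K \<chi> rule: less_induct)
  case less
  show ?case
  proof (cases "K = carrier G")
    case True
    then show ?thesis using less.prems by auto
  next
    case False
    then obtain y where y: "y \<in> carrier G" "y \<notin> K"
      using subgroup.subset[OF less.prems(1)] by blast
    obtain m :: nat where m: "m > 0" "y [^] m \<in> K" "\<forall>j. 0 < j \<and> j < m \<longrightarrow> y [^] j \<notin> K"
      using least_power_in_subgroup[OF fin less.prems(1) y(1)] by blast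
    have "cmod (\<chi> (y [^] m)) = 1" using less.prems(2) m by (auto simp: hom_circle_group_iff)
    then obtain z where z: "z ^ m = \<chi> (y [^] m)" using unit_complex_root_exists m(1) by blast
    obtain K' \<chi>' where K': "subgroup K' G" "K \<subseteq> K'" "y \<in> K'"
      and \<chi>': "\<chi>' \<in> hom (G\<lparr>carrier := K'\<rparr>) circle_group" "\<And>k. k \<in> K \<Longrightarrow> \<chi>' k = \<chi> k" "\<chi>' y = z"
      by (rule extend_character_step[OF fin less.prems y(1) m z]) (rule that)
    have "carrier G - K' \<subset> carrier G - K" using K' y by auto
    then have "card (carrier G - K') < card (carrier G - K)" using fin by (auto intro: psubset_card_mono)
    then obtain \<psi> where "\<psi> \<in> hom G circle_group" "\<forall>k\<in>K'. \<psi> k = \<chi>' k"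
      using less.hyps[OF _ K'(1) \<chi>'(1)] by blast
    then show ?thesis using K'(2) \<chi>'(2) by (metis subsetD)
  qed
qed

text \<open>The order \<open>m\<close> of \<open>x\<close> modulo \<open>H\<close> exceeds 1, so the
  trivial character of \<open>H\<close> extends to one that takes a primitive \<open>m\<close>-th
  root of unity at \<open>x\<close>.\<close>

lemma (in comm_group) separating_character:
  assumes fin: "finite (carrier G)" and H: "subgroup H G" and x: "x \<in> carrier G" "x \<notin> H"
  obtains \<psi> where "\<psi> \<in> hom G circle_group" "\<And>h. h \<in> H \<Longrightarrow> \<psi> h = 1" "\<psi> x \<noteq> 1"
proof -
  obtain m :: nat where m: "m > 0" "x [^] m \<in> H" "\<forall>j. 0 < j \<and> j < m \<longrightarrow> x [^] j \<notin> H"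
    using least_power_in_subgroup[OF fin H x(1)] by blast
  have "m \<noteq> 1" using m(2) x by auto
  let ?z = "cis (2 * pi * real 1 / real m)"
  have "?z \<noteq> cis (2 * pi * real 0 / real m)"
    using inj_onD[OF bij_betw_imp_inj_on[OF bij_betw_roots_unity[OF m(1)]], of 1 0] m(1) \<open>m \<noteq> 1\<close>
    by auto
  moreover have "?z ^ m = 1"
    using m(1) by (simp add: DeMoivre mult_ac cis_2pi[unfolded mult.commute[of 2 pi]])
  moreover have "(\<lambda>_. 1) \<in> hom (G\<lparr>carrier := H\<rparr>) circle_group"
    by (simp add: hom_circle_group_iff)
  ultimately obtain K \<chi> where K: "subgroup K G" "H \<subseteq> K" "x \<in> K"
    and \<chi>: "\<chi> \<in> hom (G\<lparr>carrier := K\<rparr>) circle_group" "\<And>h. h \<in> H \<Longrightarrow> \<chi> h = 1" "\<chi> x = ?z"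
    using extend_character_step[OF fin H _ x(1) m, of "\<lambda>_. 1" ?z] by metis
  obtain \<psi> where "\<psi> \<in> hom G circle_group" "\<forall>k\<in>K. \<psi> k = \<chi> k"
    using extend_character[OF fin K(1) \<chi>(1)] by blast
  then show ?thesis
    by (intro that[of \<psi>]) (use K \<chi> \<open>?z \<noteq> cis (2 * pi * real 0 / real m)\<close> in auto)
qed

text \<open>Extensionality makes every character occur as exactly one function; otherwise arbitrary
  values off the carrier would spoil the cardinality and the sums over this set.\<close>

definition annihilator :: "('a, 'b) monoid_scheme \<Rightarrow> 'a set \<Rightarrow> ('a \<Rightarrow> complex) set" where
  "annihilator G H = {\<psi> \<in> hom G circle_group \<inter> extensional (carrier G). \<forall>h\<in>H. \<psi> h = 1}"

lemma (in group) finite_annihilator: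
  assumes "finite (carrier G)"
  shows "finite (annihilator G H)"
proof (rule finite_subset)
  show "annihilator G H \<subseteq> carrier G \<rightarrow>\<^sub>E {z. z ^ Coset.order G = 1}"
  proof
    fix \<psi> assume \<psi>: "\<psi> \<in> annihilator G H"
    have "\<psi> x ^ Coset.order G = 1" if "x \<in> carrier G" for x
      using \<psi> hom_circle_group_pow[of \<psi> x "Coset.order G"] hom_circle_group_one[of \<psi>] that
      by (simp add: annihilator_def pow_order_eq_1)
    with \<psi> show "\<psi> \<in> carrier G \<rightarrow>\<^sub>E {z. z ^ Coset.order G = 1}"
      by (auto simp: annihilator_def PiE_def)
  qed
  have "Coset.order G > 0" using assms by (simp add: order_gt_0_iff_finite)
  then show "finite (carrier G \<rightarrow>\<^sub>E {z::complex. z ^ Coset.order G = 1})"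
    using assms by (intro finite_PiE finite_roots_unity) auto
qed

definition trivial_character :: "('a, 'b) monoid_scheme \<Rightarrow> 'a \<Rightarrow> complex" where
  "trivial_character G = (\<lambda>x\<in>carrier G. 1)"

lemma (in group) trivial_character_in_annihilator:
  assumes "H \<subseteq> carrier G"
  shows "trivial_character G \<in> annihilator G H"
  using assms by (auto simp: annihilator_def trivial_character_def hom_circle_group_iff)

text \<open>For \<open>x\<close> outside \<open>H\<close>, multiplication by a character that
  separates \<open>x\<close> from \<open>H\<close> permutes the annihilator and scales the sum by a
  factor other than 1.\<close>

lemma (in comm_group) sum_annihilator:
  assumes fin: "finite (carrier G)" and H: "subgroup H G" and x: "x \<in> carrier G"
  shows "(\<Sum>\<psi>\<in>annihilator G H. \<psi> x) = (if x \<in> H then of_nat (card (annihilator G H)) else 0)"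
proof (cases "x \<in> H")
  case True
  then show ?thesis by (simp add: annihilator_def)
next
  case False
  obtain \<psi>0 where \<psi>0: "\<psi>0 \<in> hom G circle_group" "\<And>h. h \<in> H \<Longrightarrow> \<psi>0 h = 1" "\<psi>0 x \<noteq> 1"
    using separating_character[OF fin H x False] by blast
  let ?A = "annihilator G H"
  let ?t = "\<lambda>\<psi>. \<lambda>g\<in>carrier G. \<psi>0 g * \<psi> g"
  have "?t ` ?A \<subseteq> ?A"
    using \<psi>0 subgroup.subset[OF H]
    by (auto simp: annihilator_def hom_circle_group_iff norm_mult)
  moreover have inj: "inj_on ?t ?A"
  proof (rule inj_onI)
    fix \<psi> \<psi>' assume *: "\<psi> \<in> ?A" "\<psi>' \<in> ?A" "?t \<psi> = ?t \<psi>'"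
    have "\<psi> g = \<psi>' g" if "g \<in> carrier G" for g
    proof -
      have "\<psi>0 g * \<psi> g = \<psi>0 g * \<psi>' g" using fun_cong[OF *(3), of g] that by simp
      moreover have "\<psi>0 g \<noteq> 0" using \<psi>0(1) that by (auto simp: hom_circle_group_iff)
      ultimately show ?thesis by simp
    qed
    then show "\<psi> = \<psi>'" using * by (auto simp: annihilator_def intro: extensionalityI)
  qed
  ultimately have "?t ` ?A = ?A"
    using finite_annihilator[OF fin] by (simp add: endo_inj_surj)
  then have "(\<Sum>\<psi>\<in>?A. \<psi> x) = (\<Sum>\<psi>\<in>?A. ?t \<psi> x)"
    using sum.reindex[OF inj, of "\<lambda>\<psi>. \<psi> x"] by (simp add: o_def)
  also have "\<dots> = \<psi>0 x * (\<Sum>\<psi>\<in>?A. \<psi> x)"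
    using x by (simp add: sum_distrib_left)
  finally show ?thesis using \<psi>0(3) False by auto
qed

lemma (in group) sum_nontrivial_character:
  assumes \<psi>: "\<psi> \<in> hom G circle_group" and a: "a \<in> carrier G" "\<psi> a \<noteq> 1"
  shows "(\<Sum>x\<in>carrier G. \<psi> x) = 0"
proof -
  have "bij_betw (\<lambda>x. a \<otimes> x) (carrier G) (carrier G)"
    using a by (intro bij_betwI[where g = "\<lambda>x. inv a \<otimes> x"]) (auto simp: m_assoc[symmetric])
  then have "(\<Sum>x\<in>carrier G. \<psi> x) = (\<Sum>x\<in>carrier G. \<psi> (a \<otimes> x))"
    by (rule sum.reindex_bij_betw[symmetric])
  also have "\<dots> = \<psi> a * (\<Sum>x\<in>carrier G. \<psi> x)"
    using \<psi> a by (simp add: hom_circle_group_iff sum_distrib_left)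
  finally show ?thesis using a by auto
qed

lemma (in group) nontrivial_if_ne_trivial_character:
  assumes "\<psi> \<in> annihilator G H" "\<psi> \<noteq> trivial_character G"
  shows "\<exists>x\<in>carrier G. \<psi> x \<noteq> 1"
proof (rule ccontr)
  assume "\<not> ?thesis"
  then have "\<psi> = trivial_character G"
    using assms(1) by (intro extensionalityI[of _ "carrier G"])
      (auto simp: annihilator_def trivial_character_def)
  with assms show False by simp
qed

text \<open>Double counting of all values \<open>\<psi> x\<close>: summed over \<open>x\<close>
  first, only the trivial character survives; summed over \<open>\<psi>\<close> first, only the
  points of \<open>H\<close> do.\<close>

lemma (in comm_group) card_annihilator:
  assumes fin: "finite (carrier G)" and H: "subgroup H G"
  shows "card (annihilator G H) * card H = card (carrier G)"
proof -
  let ?A = "annihilator G H" and ?t = "trivial_character G"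
  have HG: "H \<subseteq> carrier G" by (rule subgroup.subset[OF H])
  have "(\<Sum>x\<in>carrier G. \<Sum>\<psi>\<in>?A. \<psi> x) = (\<Sum>\<psi>\<in>?A. \<Sum>x\<in>carrier G. \<psi> x)"
    by (rule sum.swap)
  also have "\<dots> = (\<Sum>x\<in>carrier G. ?t x) + (\<Sum>\<psi>\<in>?A - {?t}. \<Sum>x\<in>carrier G. \<psi> x)"
    by (rule sum.remove[OF finite_annihilator[OF fin] trivial_character_in_annihilator[OF HG]])
  also have "(\<Sum>\<psi>\<in>?A - {?t}. \<Sum>x\<in>carrier G. \<psi> x) = 0"
  proof (rule sum.neutral, rule ballI)
    fix \<psi> assume *: "\<psi> \<in> ?A - {?t}"
    then obtain a where "a \<in> carrier G" "\<psi> a \<noteq> 1"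
      using nontrivial_if_ne_trivial_character[of \<psi> H] by auto
    with * show "(\<Sum>x\<in>carrier G. \<psi> x) = 0"
      by (intro sum_nontrivial_character[of \<psi> a]) (auto simp: annihilator_def)
  qed
  also have "(\<Sum>x\<in>carrier G. ?t x) = of_nat (card (carrier G))"
    by (simp add: trivial_character_def)
  finally have "(\<Sum>x\<in>carrier G. \<Sum>\<psi>\<in>?A. \<psi> x) = of_nat (card (carrier G))" by simp
  moreover have "(\<Sum>x\<in>carrier G. \<Sum>\<psi>\<in>?A. \<psi> x) = (\<Sum>x\<in>carrier G. if x \<in> H then of_nat (card ?A) else 0)"
    using sum_annihilator[OF fin H] by (intro sum.cong) auto
  moreover have "\<dots> = of_nat (card ?A * card H)"
    using fin HG by (simp add: sum.If_cases Int_absorb1 mult.commute)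
  ultimately have "(of_nat (card ?A * card H) :: complex) = of_nat (card (carrier G))" by simp
  then show ?thesis by (simp only: of_nat_eq_iff)
qed

text \<open>The Salem condition without its normalization, for an arbitrary finite abelian group, so
  that both counting arguments are free of ring structure.\<close>

locale character_sum_bound = comm_group +
  fixes V :: "'a set" and M :: real
  assumes fin: "finite (carrier G)" and V: "V \<subseteq> carrier G" and M: "M \<ge> 0"
    and bound: "\<And>\<psi> x. \<psi> \<in> hom G circle_group \<Longrightarrow> x \<in> carrier G \<Longrightarrow> \<psi> x \<noteq> 1 \<Longrightarrow>
      cmod (\<Sum>v\<in>V. \<psi> v) \<le> M"
begin

lemma bound_annihilator:
  assumes "\<psi> \<in> annihilator G H - {trivial_character G}"
  shows "cmod (\<Sum>v\<in>V. \<psi> v) \<le> M"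
  using assms nontrivial_if_ne_trivial_character[of \<psi> H] bound[of \<psi>] by (auto simp: annihilator_def)

lemma card_inter_subgroup_le:
  assumes H: "subgroup H G"
  shows "real (card (V \<inter> H)) \<le> real (card V) * real (card H) / real (card (carrier G)) + M"
proof -
  let ?A = "annihilator G H" and ?t = "trivial_character G"
  have HG: "H \<subseteq> carrier G" by (rule subgroup.subset[OF H])
  have finV: "finite V" using V fin finite_subset by blast
  have tA: "?t \<in> ?A" by (rule trivial_character_in_annihilator[OF HG])
  note finA = finite_annihilator[OF fin, of H]
  have "(\<Sum>\<psi>\<in>?A. \<Sum>v\<in>V. \<psi> v) = (\<Sum>v\<in>V. \<Sum>\<psi>\<in>?A. \<psi> v)" by (rule sum.swap)
  also have "\<dots> = (\<Sum>v\<in>V. if v \<in> H then of_nat (card ?A) else 0)"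
    using sum_annihilator[OF fin H] V by (intro sum.cong) auto
  also have "\<dots> = of_nat (card ?A * card (V \<inter> H))"
    using finV by (simp add: sum.If_cases mult.commute)
  finally have "real (card ?A * card (V \<inter> H)) = cmod (\<Sum>\<psi>\<in>?A. \<Sum>v\<in>V. \<psi> v)"
    by (simp add: norm_mult)
  also have "\<dots> \<le> (\<Sum>\<psi>\<in>?A. cmod (\<Sum>v\<in>V. \<psi> v))" by (rule norm_sum)
  also have "\<dots> = cmod (\<Sum>v\<in>V. ?t v) + (\<Sum>\<psi>\<in>?A - {?t}. cmod (\<Sum>v\<in>V. \<psi> v))"
    by (rule sum.remove[OF finA tA])
  also have "(\<Sum>v\<in>V. ?t v) = of_nat (card V)"
    using V by (simp add: trivial_character_def subset_iff)
  also have "(\<Sum>\<psi>\<in>?A - {?t}. cmod (\<Sum>v\<in>V. \<psi> v)) \<le> (\<Sum>\<psi>\<in>?A - {?t}. M)"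
    by (rule sum_mono) (rule bound_annihilator)
  also have "\<dots> \<le> real (card ?A) * M"
    using M card_Diff1_le[of ?A ?t] by (simp add: mult_right_mono)
  finally have le: "real (card ?A) * real (card (V \<inter> H)) \<le> real (card V) + real (card ?A) * M"
    by simp
  have A: "card ?A > 0" using tA finA by (auto simp: card_gt_0_iff)
  have "card H > 0"
    using H fin HG finite_subset subgroup.one_closed[OF H] by (auto simp: card_gt_0_iff)
  \<comment> \<open>The duality \<open>card ?A * card H = card (carrier G)\<close> rewrites the
    trivial character's share \<open>card V / card ?A\<close> as the expected number of
    points.\<close>
  then have eq: "real (card V) * real (card H) / real (card (carrier G)) = real (card V) / real (card ?A)"
    unfolding card_annihilator[OF fin H, symmetric] by simp
  show ?thesis unfolding eq using le A by (simp add: field_simps)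
qed

text \<open>Inverses correspond to complex conjugates, so the squared modulus of a character sum
  expands into values at \<open>u v^(-1)\<close> over pairs; orthogonality then selects the pairs
  congruent modulo \<open>H\<close>.\<close>

lemma card_pairs_le:
  assumes H: "subgroup H G"
  shows "real (card {p \<in> V \<times> V. fst p \<otimes> inv (snd p) \<in> H}) \<le>
    (real (card V))\<^sup>2 * real (card H) / real (card (carrier G)) + M\<^sup>2"
proof -
  let ?A = "annihilator G H" and ?t = "trivial_character G"
  let ?P = "{p \<in> V \<times> V. fst p \<otimes> inv (snd p) \<in> H}"
  have HG: "H \<subseteq> carrier G" by (rule subgroup.subset[OF H])
  have finV: "finite V" using V fin finite_subset by blast
  have tA: "?t \<in> ?A" by (rule trivial_character_in_annihilator[OF HG])
  note finA = finite_annihilator[OF fin, of H]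
  have "(\<Sum>\<psi>\<in>?A. (\<Sum>v\<in>V. \<psi> v) * cnj (\<Sum>v\<in>V. \<psi> v)) = (\<Sum>\<psi>\<in>?A. \<Sum>p\<in>V \<times> V. \<psi> (fst p \<otimes> inv (snd p)))"
  proof (rule sum.cong[OF refl])
    fix \<psi> assume "\<psi> \<in> ?A"
    then have \<psi>: "\<psi> \<in> hom G circle_group" by (simp add: annihilator_def)
    have "(\<Sum>v\<in>V. \<psi> v) * cnj (\<Sum>v\<in>V. \<psi> v) = (\<Sum>p\<in>V \<times> V. \<psi> (fst p) * cnj (\<psi> (snd p)))"
      by (simp add: sum_product sum.cartesian_product case_prod_beta)
    also have "\<dots> = (\<Sum>p\<in>V \<times> V. \<psi> (fst p \<otimes> inv (snd p)))"
    proof (rule sum.cong[OF refl])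
      fix p assume "p \<in> V \<times> V"
      then have "fst p \<in> carrier G" "snd p \<in> carrier G" using V by auto
      then show "\<psi> (fst p) * cnj (\<psi> (snd p)) = \<psi> (fst p \<otimes> inv (snd p))"
        using \<psi> hom_circle_group_inv[OF \<psi>] by (simp add: hom_circle_group_iff)
    qed
    finally show "(\<Sum>v\<in>V. \<psi> v) * cnj (\<Sum>v\<in>V. \<psi> v) = (\<Sum>p\<in>V \<times> V. \<psi> (fst p \<otimes> inv (snd p)))" .
  qed
  also have "\<dots> = (\<Sum>p\<in>V \<times> V. \<Sum>\<psi>\<in>?A. \<psi> (fst p \<otimes> inv (snd p)))" by (rule sum.swap)
  also have "\<dots> = (\<Sum>p\<in>V \<times> V. if fst p \<otimes> inv (snd p) \<in> H then of_nat (card ?A) else 0)"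
    using V by (intro sum.cong[OF refl] sum_annihilator[OF fin H]) (auto simp: subset_iff)
  also have "\<dots> = of_nat (card ?A * card ?P)"
    using finV by (simp add: sum.If_cases mult.commute Int_def)
  also have "(\<Sum>\<psi>\<in>?A. (\<Sum>v\<in>V. \<psi> v) * cnj (\<Sum>v\<in>V. \<psi> v)) =
      of_real (\<Sum>\<psi>\<in>?A. (cmod (\<Sum>v\<in>V. \<psi> v))\<^sup>2)"
    unfolding of_real_sum complex_norm_square ..
  finally have "(of_real (\<Sum>\<psi>\<in>?A. (cmod (\<Sum>v\<in>V. \<psi> v))\<^sup>2) :: complex) = of_real (real (card ?A * card ?P))"
    by (simp only: of_real_of_nat_eq)
  then have "real (card ?A * card ?P) = (\<Sum>\<psi>\<in>?A. (cmod (\<Sum>v\<in>V. \<psi> v))\<^sup>2)"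
    by (simp only: of_real_eq_iff)
  also have "\<dots> = (cmod (\<Sum>v\<in>V. ?t v))\<^sup>2 + (\<Sum>\<psi>\<in>?A - {?t}. (cmod (\<Sum>v\<in>V. \<psi> v))\<^sup>2)"
    by (rule sum.remove[OF finA tA])
  also have "(\<Sum>v\<in>V. ?t v) = of_nat (card V)"
    using V by (simp add: trivial_character_def subset_iff)
  also have "(\<Sum>\<psi>\<in>?A - {?t}. (cmod (\<Sum>v\<in>V. \<psi> v))\<^sup>2) \<le> (\<Sum>\<psi>\<in>?A - {?t}. M\<^sup>2)"
    by (intro sum_mono power_mono bound_annihilator) auto
  also have "\<dots> \<le> real (card ?A) * M\<^sup>2"
    using card_Diff1_le[of ?A ?t] by (simp add: mult_right_mono)
  finally have le: "real (card ?A) * real (card ?P) \<le> (real (card V))\<^sup>2 + real (card ?A) * M\<^sup>2"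
    by simp
  have A: "card ?A > 0" using tA finA by (auto simp: card_gt_0_iff)
  have "card H > 0"
    using H fin HG finite_subset subgroup.one_closed[OF H] by (auto simp: card_gt_0_iff)
  then have eq: "(real (card V))\<^sup>2 * real (card H) / real (card (carrier G)) = (real (card V))\<^sup>2 / real (card ?A)"
    unfolding card_annihilator[OF fin H, symmetric] by simp
  show ?thesis unfolding eq using le A by (simp add: field_simps)
qed

end

section \<open>Salem graphs over finite rings\<close>

lemma eval_word_cong:
  "(\<And>i. i \<in> set w \<Longrightarrow> x i = y i) \<Longrightarrow> eval_word R x w = eval_word R y w"
  by (induction w) (auto simp: eval_word_def)

text \<open>The definitions of the statement only accept ring records without additional fields.\<close>

locale unextended_ring = ring R for R :: "'a ring" (structure)

lemma (in unextended_ring) eval_word_closed: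
  "(\<And>i. i \<in> set w \<Longrightarrow> x i \<in> carrier R) \<Longrightarrow> eval_word R x w \<in> carrier R"
  by (induction w) (auto simp: eval_word_def)

text \<open>That \<open>A\<close> contains \<open>\<one>\<close> is what settles the empty
  word.\<close>

lemma (in unextended_ring) eval_word_subring:
  assumes "subring A R"
  shows "(\<And>i. i \<in> set w \<Longrightarrow> x i \<in> A) \<Longrightarrow> eval_word R x w \<in> A"
  using subringE[OF assms] by (induction w) (auto simp: eval_word_def)

text \<open>Induction through \<open>x a - y b = x (a - b) + (x - y) b\<close>; the two summands use
  absorption on opposite sides.\<close>

lemma (in unextended_ring) eval_word_ideal_cong:
  assumes I: "ideal I R"
  shows "(\<And>i. i \<in> set w \<Longrightarrow> x i \<in> carrier R \<and> y i \<in> carrier R \<and> x i \<ominus> y i \<in> I) \<Longrightarrow>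
    eval_word R x w \<ominus> eval_word R y w \<in> I"
proof (induction w)
  case Nil
  then show ?case using ideal.axioms(1)[OF I]
    by (simp add: eval_word_def a_minus_def r_neg additive_subgroup.zero_closed)
next
  case (Cons i w)
  interpret I: ideal I R by (rule I)
  let ?a = "eval_word R x w" and ?b = "eval_word R y w"
  have c: "x i \<in> carrier R" "y i \<in> carrier R" "x i \<ominus> y i \<in> I" "?a \<ominus> ?b \<in> I"
    using Cons by auto
  have ab: "?a \<in> carrier R" "?b \<in> carrier R"
    using Cons.prems by (auto intro!: eval_word_closed)
  have "x i \<otimes> ?a \<ominus> y i \<otimes> ?b = x i \<otimes> (?a \<ominus> ?b) \<oplus> (x i \<ominus> y i) \<otimes> ?b"
    using c(1,2) ab by (simp add: a_minus_def r_distr l_distr r_minus l_minus a_assoc r_neg1)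
  moreover have "\<dots> \<in> I"
    using c ab I.I_l_closed I.I_r_closed by simp
  ultimately show ?case by (simp add: eval_word_def)
qed

lemma (in abelian_group) finsum_in_subgroup:
  assumes "subgroup H (add_monoid G)" "finite A" "\<And>a. a \<in> A \<Longrightarrow> g a \<in> H"
  shows "(\<Oplus>a\<in>A. g a) \<in> H"
  using assms(2,3)
proof (induction A rule: finite_induct)
  case empty
  then show ?case using subgroup.one_closed[OF assms(1)] by simp
next
  case (insert a A)
  moreover have "H \<subseteq> carrier G" using subgroup.subset[OF assms(1)] by simp
  ultimately show ?case using subgroup.m_closed[OF assms(1)] by (subst finsum_insert) auto
qed

lemma (in abelian_group) add_pow_int_in_subgroup:
  assumes "subgroup H (add_monoid G)" "a \<in> H"
  shows "[(n::int)] \<cdot>\<^bsub>G\<^esub> a \<in> H"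
  using add.subgroup_int_pow_closed[OF assms] by (simp add: add_pow_def)

lemma ncpolys_keysD:
  assumes "f \<in> ncpolys m" "w \<in> Poly_Mapping.keys f" "i \<in> set w"
  shows "i \<in> {1..m}"
  using assms by (auto simp: ncpolys_def)

lemma (in unextended_ring) eval_ncpoly_subring:
  assumes A: "subring A R" and f: "f \<in> ncpolys m" and x: "\<And>i. i \<in> {1..m} \<Longrightarrow> x i \<in> A"
  shows "eval_ncpoly R x f \<in> A"
  unfolding eval_ncpoly_def
  using subring.axioms(1)[OF A] ncpolys_keysD[OF f] x
  by (intro finsum_in_subgroup add_pow_int_in_subgroup eval_word_subring[OF A]) auto

lemma (in unextended_ring) eval_ncpoly_ideal_cong:
  assumes I: "ideal I R" and f: "f \<in> ncpolys m"
    and xy: "\<And>i. i \<in> {1..m} \<Longrightarrow> x i \<in> carrier R \<and> y i \<in> carrier R \<and> x i \<ominus> y i \<in> I"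
  shows "eval_ncpoly R x f \<ominus> eval_ncpoly R y f \<in> I"
proof -
  let ?g = "\<lambda>x w. [Poly_Mapping.lookup f w] \<cdot>\<^bsub>R\<^esub> eval_word R x w"
  have sub: "subgroup I (add_monoid R)"
    by (rule additive_subgroup.a_subgroup[OF ideal.axioms(1)[OF I]])
  have w: "eval_word R x w \<in> carrier R" "eval_word R y w \<in> carrier R"
    "eval_word R x w \<ominus> eval_word R y w \<in> I" if "w \<in> Poly_Mapping.keys f" for w
    using ncpolys_keysD[OF f that] xy
    by (auto intro!: eval_word_closed eval_word_ideal_cong[OF I])
  have g: "?g x w \<in> carrier R" "?g y w \<in> carrier R" if "w \<in> Poly_Mapping.keys f" for w
    using w[OF that] by auto
  have "?g x w \<ominus> ?g y w \<in> I" if "w \<in> Poly_Mapping.keys f" for w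
  proof -
    have "?g x w \<ominus> ?g y w = [Poly_Mapping.lookup f w] \<cdot>\<^bsub>R\<^esub> (eval_word R x w \<ominus> eval_word R y w)"
      using w(1,2)[OF that] by (simp add: a_minus_def add.int_pow_distrib add.int_pow_inv)
    then show ?thesis using add_pow_int_in_subgroup[OF sub w(3)[OF that]] by simp
  qed
  then have "(\<Oplus>w\<in>Poly_Mapping.keys f. ?g x w \<ominus> ?g y w) \<in> I"
    by (intro finsum_in_subgroup[OF sub]) auto
  moreover have "(\<Oplus>w\<in>Poly_Mapping.keys f. ?g x w) =
      (\<Oplus>w\<in>Poly_Mapping.keys f. ?g x w \<ominus> ?g y w) \<oplus> (\<Oplus>w\<in>Poly_Mapping.keys f. ?g y w)"
  proof -
    have "(\<Oplus>w\<in>Poly_Mapping.keys f. ?g x w \<ominus> ?g y w) \<oplus> (\<Oplus>w\<in>Poly_Mapping.keys f. ?g y w) =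
        (\<Oplus>w\<in>Poly_Mapping.keys f. (?g x w \<ominus> ?g y w) \<oplus> ?g y w)"
      by (rule finsum_addf[symmetric]) (use g in auto)
    also have "\<dots> = (\<Oplus>w\<in>Poly_Mapping.keys f. ?g x w)"
      by (rule finsum_cong') (use g in \<open>auto simp: a_minus_def a_assoc l_neg\<close>)
    finally show ?thesis by simp
  qed
  moreover have "(\<Oplus>w\<in>Poly_Mapping.keys f. ?g y w) \<in> carrier R"
    "(\<Oplus>w\<in>Poly_Mapping.keys f. ?g x w \<ominus> ?g y w) \<in> carrier R"
    using g by (auto intro!: finsum_closed)
  ultimately show ?thesis
    unfolding eval_ncpoly_def by (simp add: a_minus_def a_assoc r_neg)
qed

lemma (in unextended_ring) eval_ncpoly_cong:
  assumes f: "f \<in> ncpolys m" and eq: "\<And>i. i \<in> {1..m} \<Longrightarrow> x i = y i"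
    and x: "\<And>i. i \<in> {1..m} \<Longrightarrow> x i \<in> carrier R"
  shows "eval_ncpoly R x f = eval_ncpoly R y f"
proof -
  have "eval_word R x w = eval_word R y w" if "w \<in> Poly_Mapping.keys f" for w
    using eq ncpolys_keysD[OF f that] by (intro eval_word_cong) auto
  moreover have "eval_word R x w \<in> carrier R" if "w \<in> Poly_Mapping.keys f" for w
    using x ncpolys_keysD[OF f that] by (intro eval_word_closed) auto
  ultimately show ?thesis
    unfolding eval_ncpoly_def by (intro finsum_cong') auto
qed

section \<open>The additive group \<open>R^d\<close> and the points of the graph\<close>

lemma carrier_power_group: "carrier (power_group d R) = {1..d} \<rightarrow>\<^sub>E carrier R"
  by (simp add: power_group_def)

lemma (in unextended_ring) comm_group_power_group: "comm_group (power_group d R)"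
proof -
  have "group (power_group d R)"
    unfolding power_group_def by (intro product_group a_group)
  then show ?thesis
    by (rule group.group_comm_groupI)
      (auto simp: power_group_def PiE_iff a_comm intro!: restrict_ext)
qed

lemma (in unextended_ring) inv_power_group:
  assumes "x \<in> carrier (power_group d R)"
  shows "inv\<^bsub>power_group d R\<^esub> x = (\<lambda>i\<in>{1..d}. \<ominus> x i)"
proof -
  have "inv\<^bsub>power_group d R\<^esub> x = (\<lambda>i\<in>{1..d}. inv\<^bsub>add_monoid R\<^esub> x i)"
    unfolding power_group_def using assms
    by (intro inv_product_group a_group) (simp add: power_group_def)
  then show ?thesis by (simp only: a_inv_def)
qed

lemma (in unextended_ring) subgroup_power_group:
  assumes "subgroup A (add_monoid R)"
  shows "subgroup ({1..d} \<rightarrow>\<^sub>E A) (power_group d R)"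
  unfolding power_group_def
  using assms a_group by (subst PiE_subgroup_product_group) auto

text \<open>The first \<open>d - 1\<close> coordinates parametrize the graph. The sets
  \<open>B i\<close> stay free because the count is used with the whole ring, with a subring, and
  with cosets of an ideal that vary with \<open>i\<close>.\<close>

lemma (in unextended_ring) card_graph_variety_box:
  assumes d: "d \<ge> 1" and f: "f \<in> ncpolys (d - 1)"
    and B: "\<And>i. i \<in> {1..d - 1} \<Longrightarrow> B i \<subseteq> carrier R"
  shows "card {y \<in> graph_variety d f R. \<forall>i\<in>{1..d - 1}. y i \<in> B i} = (\<Prod>i\<in>{1..d - 1}. card (B i))"
proof -
  let ?S = "{y \<in> graph_variety d f R. \<forall>i\<in>{1..d - 1}. y i \<in> B i}"
  let ?g = "\<lambda>y. \<lambda>i\<in>{1..d}. if i = d then eval_ncpoly R y f else y i"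
  have sub: "subring (carrier R) R" by (rule carrier_is_subring)
  \<comment> \<open>The variables of \<open>f\<close> have index at most \<open>d - 1\<close>, so
    writing a value at index \<open>d\<close> does not change the evaluation.\<close>
  have eval_g: "eval_ncpoly R (?g y) f = eval_ncpoly R y f" if "y \<in> Pi\<^sub>E {1..d - 1} B" for y
    by (rule eval_ncpoly_cong[OF f]) (use that B d in \<open>force simp: PiE_iff\<close>)+
  have "bij_betw (\<lambda>y. restrict y {1..d - 1}) ?S (Pi\<^sub>E {1..d - 1} B)"
  proof (rule bij_betwI[where g = ?g])
    show "(\<lambda>y. restrict y {1..d - 1}) \<in> ?S \<rightarrow> Pi\<^sub>E {1..d - 1} B" by auto
    show "?g \<in> Pi\<^sub>E {1..d - 1} B \<rightarrow> ?S"
    proof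
      fix y assume y: "y \<in> Pi\<^sub>E {1..d - 1} B"
      have yR: "y i \<in> carrier R" if "i \<in> {1..d - 1}" for i
        using PiE_mem[OF y that] B[OF that] by blast
      then have "eval_ncpoly R y f \<in> carrier R" by (intro eval_ncpoly_subring[OF sub f])
      moreover have "i \<in> {1..d - 1}" if "i \<in> {1..d}" "i \<noteq> d" for i using that by auto
      ultimately have "?g y \<in> carrier (power_group d R)"
        using yR by (auto simp: carrier_power_group)
      moreover have "?g y i \<in> B i" if "i \<in> {1..d - 1}" for i
        using that y d by (auto simp: PiE_iff)
      ultimately show "?g y \<in> ?S"
        using eval_g[OF y] d by (simp add: graph_variety_def)
    qed
    show "?g (restrict y {1..d - 1}) = y" if "y \<in> ?S" for y
    proof
      fix i
      have y: "y \<in> carrier (power_group d R)" "y d = eval_ncpoly R y f"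
        using that by (auto simp: graph_variety_def)
      have "eval_ncpoly R (restrict y {1..d - 1}) f = eval_ncpoly R y f"
        by (rule eval_ncpoly_cong[OF f]) (use y in \<open>auto simp: carrier_power_group PiE_iff\<close>)
      then show "?g (restrict y {1..d - 1}) i = y i"
        using y d by (auto simp: carrier_power_group PiE_iff extensional_def)
    qed
    show "restrict (?g y) {1..d - 1} = y" if "y \<in> Pi\<^sub>E {1..d - 1} B" for y
    proof
      fix i show "restrict (?g y) {1..d - 1} i = y i"
        using that d by (auto simp: PiE_iff extensional_def)
    qed
  qed
  then have "card ?S = card (Pi\<^sub>E {1..d - 1} B)" by (rule bij_betw_same_card)
  then show ?thesis by (simp add: card_PiE)
qed

lemma (in unextended_ring) card_graph_variety:
  assumes "d \<ge> 1" "f \<in> ncpolys (d - 1)"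
  shows "card (graph_variety d f R) = card (carrier R) ^ (d - 1)"
proof -
  have "graph_variety d f R = {y \<in> graph_variety d f R. \<forall>i\<in>{1..d - 1}. y i \<in> carrier R}"
    using assms by (auto simp: graph_variety_def carrier_power_group PiE_iff)
  then show ?thesis using card_graph_variety_box[OF assms, of "\<lambda>_. carrier R"] by simp
qed

text \<open>The power of the ring order cancels from both sides of the Salem inequality. The
  definition admits a negative \<open>C\<close> while the locale demands a nonnegative bound, whence
  \<open>max C 0\<close>.\<close>

lemma (in unextended_ring) character_sum_bound_graph_variety:
  assumes fin: "finite (carrier R)" and salem: "salem_set C d R (graph_variety d f R)"
  shows "character_sum_bound (power_group d R) (graph_variety d f R)
    (max C 0 * sqrt (real (card (graph_variety d f R))))"
proof (intro character_sum_bound.intro comm_group_power_group character_sum_bound_axioms.intro)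
  let ?V = "graph_variety d f R"
  show "finite (carrier (power_group d R))" using fin by (simp add: carrier_power_group finite_PiE)
  show "?V \<subseteq> carrier (power_group d R)" using salem by (simp add: salem_set_def)
  fix \<psi> x assume "\<psi> \<in> hom (power_group d R) circle_group" "x \<in> carrier (power_group d R)" "\<psi> x \<noteq> 1"
  then have "cmod (fourier_coeff d R ?V \<psi>) \<le> C / real (card (carrier R)) ^ d * sqrt (real (card ?V))"
    using salem by (auto simp: salem_set_def nontrivial_characters_def)
  moreover have "card (carrier R) > 0" using fin by (auto simp: card_gt_0_iff)
  ultimately have "cmod (\<Sum>v\<in>?V. \<psi> v) \<le> C * sqrt (real (card ?V))"
    by (simp add: fourier_coeff_def norm_mult norm_divide norm_power field_simps)
  also have "\<dots> \<le> max C 0 * sqrt (real (card ?V))" by (intro mult_right_mono) auto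
  finally show "cmod (\<Sum>v\<in>?V. \<psi> v) \<le> max C 0 * sqrt (real (card ?V))" .
qed simp

section \<open>Size bounds for proper subrings and ideals\<close>

lemma (in abelian_group) card_proper_subgroup_le_half:
  assumes fin: "finite (carrier G)" and H: "subgroup H (add_monoid G)" "H \<noteq> carrier G"
  shows "2 * card H \<le> card (carrier G)"
proof -
  have "H \<subset> carrier G" using subgroup.subset[OF H(1)] H(2) by auto
  then have less: "card H < card (carrier G)" using fin by (simp add: psubset_card_mono)
  obtain k where k: "card (carrier G) = k * card H"
    using group.lagrange[OF a_group H(1)] by (metis Coset.order_def partial_object.select_convs(1))
  with less have "k \<noteq> 0" "k \<noteq> 1" by auto
  then have "k \<ge> 2" by simp
  with k show ?thesis by simp
qed

text \<open>With \<open>a = card A\<close> and \<open>e = d - 1\<close>, the graph has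
  \<open>a^e\<close> points over \<open>A\<close>, far more than the trivial character predicts; so
  the error \<open>M\<close>, of order \<open>N^(e/2)\<close>, must account for at least half of
  them.\<close>

lemma (in unextended_ring) card_proper_subring_bound:
  assumes finR: "finite (carrier R)" and d: "d \<ge> 2" and f: "f \<in> ncpolys (d - 1)"
    and salem: "salem_set C d R (graph_variety d f R)"
    and A: "subring A R" "A \<noteq> carrier R"
  shows "real ((card A)\<^sup>2) \<le> max 1 (4 * C\<^sup>2) * real (card (carrier R))"
proof -
  let ?V = "graph_variety d f R" and ?G = "power_group d R"
  let ?H = "{1..d} \<rightarrow>\<^sub>E A"
  define N where "N = real (card (carrier R))"
  define a where "a = real (card A)"
  define e where "e = d - 1"
  have e: "d = Suc e" "e \<ge> 1" using d by (auto simp: e_def)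
  define M where "M = max C 0 * sqrt (N ^ e)"
  have AR: "A \<subseteq> carrier R" by (rule subringE(1)[OF A(1)])
  have N: "N > 0" unfolding N_def using finR by (auto simp: card_gt_0_iff)
  have cardV: "card ?V = card (carrier R) ^ e" using card_graph_variety[OF _ f] d by (simp add: e_def)
  interpret character_sum_bound ?G ?V M
    using character_sum_bound_graph_variety[OF finR salem] by (simp add: M_def N_def cardV)
  have sub: "subgroup A (add_monoid R)" by (rule subring.axioms(1)[OF A(1)])
  have "?V \<inter> ?H = {y \<in> ?V. \<forall>i\<in>{1..d - 1}. y i \<in> A}"
  proof (intro equalityI subsetI)
    fix y assume y: "y \<in> {y \<in> ?V. \<forall>i\<in>{1..d - 1}. y i \<in> A}"
    then have "eval_ncpoly R y f \<in> A" by (intro eval_ncpoly_subring[OF A(1) f]) auto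
    then have "y d \<in> A" using y by (simp add: graph_variety_def)
    moreover have "y i \<in> A" if "i \<in> {1..d}" "i \<noteq> d" for i
      using y that by auto
    ultimately have "y i \<in> A" if "i \<in> {1..d}" for i using that by metis
    then show "y \<in> ?V \<inter> ?H" using y by (auto simp: graph_variety_def carrier_power_group PiE_iff)
  qed (use d in auto)
  then have "card (?V \<inter> ?H) = card A ^ e"
    using card_graph_variety_box[OF _ f, of "\<lambda>_. A"] AR d by (simp add: e_def)
  moreover have "card (carrier ?G) = card (carrier R) ^ d" "card ?H = card A ^ d"
    by (simp_all add: carrier_power_group card_PiE)
  ultimately have "a ^ e \<le> N ^ e * a ^ d / N ^ d + M"
    using card_inter_subgroup_le[OF subgroup_power_group[OF sub]] cardV
    by (simp add: a_def N_def)
  also have "N ^ e * a ^ d / N ^ d = a ^ e * (a / N)"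
    using N by (simp add: e(1))
  \<comment> \<open>A proper subgroup has index at least 2, so this term is absorbed by the left
    side; hence the 2 in \<open>2 * M\<close>, and after squaring the 4 in the bound.\<close>
  also have "a ^ e * (a / N) \<le> a ^ e * (1 / 2)"
  proof (rule mult_left_mono)
    show "a / N \<le> 1 / 2"
      using card_proper_subgroup_le_half[OF finR sub A(2)] N by (simp add: a_def N_def field_simps)
  qed (simp add: a_def)
  finally have "a ^ e \<le> 2 * M" by simp
  moreover have "0 \<le> a ^ e" by (simp add: a_def)
  ultimately have "(a ^ e)\<^sup>2 \<le> (2 * M)\<^sup>2" by (intro power_mono)
  also have "\<dots> = 4 * (max C 0)\<^sup>2 * N ^ e"
    using N by (simp add: M_def power_mult_distrib)
  also have "\<dots> \<le> 4 * C\<^sup>2 * N ^ e"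
    using N by (intro mult_right_mono) (auto simp: max_def)
  finally have "(a\<^sup>2 / N) ^ e \<le> 4 * C\<^sup>2"
    using N by (simp add: power_divide power_mult[symmetric] mult.commute pos_divide_le_eq)
  \<comment> \<open>Taking an \<open>e\<close>-th root is avoided: a ratio of at least 1 is bounded
    by its \<open>e\<close>-th power, and a smaller one explains the 1 inside
    \<open>max\<close>.\<close>
  moreover have "a\<^sup>2 / N \<le> 1 \<or> a\<^sup>2 / N \<le> (a\<^sup>2 / N) ^ e"
    using self_le_power[of "a\<^sup>2 / N" e] e(2) by (cases "1 \<le> a\<^sup>2 / N") auto
  ultimately have "a\<^sup>2 / N \<le> max 1 (4 * C\<^sup>2)" by linarith
  then show ?thesis using N by (simp add: pos_divide_le_eq a_def N_def)
qed

text \<open>Each of the \<open>N^e\<close> points is congruent to \<open>a^e\<close> points, where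
  \<open>a = card I\<close> and \<open>e = d - 1\<close>. Since \<open>M^2\<close> also carries the
  factor \<open>N^e\<close>, the ring order cancels and a bound in \<open>C\<close> alone
  remains.\<close>

lemma (in unextended_ring) card_proper_ideal_bound:
  assumes finR: "finite (carrier R)" and d: "d \<ge> 2" and f: "f \<in> ncpolys (d - 1)"
    and salem: "salem_set C d R (graph_variety d f R)"
    and I: "ideal I R" "I \<noteq> carrier R"
  shows "real (card I) \<le> 2 * C\<^sup>2"
proof -
  let ?V = "graph_variety d f R" and ?G = "power_group d R"
  let ?H = "{1..d} \<rightarrow>\<^sub>E I"
  define N where "N = real (card (carrier R))"
  define a where "a = real (card I)"
  define e where "e = d - 1"
  have e: "d = Suc e" "e \<ge> 1" using d by (auto simp: e_def)
  define M where "M = max C 0 * sqrt (N ^ e)"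
  interpret I: ideal I R by (rule I(1))
  have IR: "I \<subseteq> carrier R" by auto
  have N: "N > 0" unfolding N_def using finR by (auto simp: card_gt_0_iff)
  have cardV: "card ?V = card (carrier R) ^ e" using card_graph_variety[OF _ f] d by (simp add: e_def)
  interpret character_sum_bound ?G ?V M
    using character_sum_bound_graph_variety[OF finR salem] by (simp add: M_def N_def cardV)
  have sub: "subgroup I (add_monoid R)" by (rule I.a_subgroup)
  let ?P = "{p \<in> ?V \<times> ?V. fst p \<otimes>\<^bsub>?G\<^esub> inv\<^bsub>?G\<^esub> (snd p) \<in> ?H}"
  \<comment> \<open>The condition at index \<open>d\<close> follows from the others, as the
    polynomial respects congruence modulo \<open>I\<close>.\<close>
  have diff_iff: "x \<otimes>\<^bsub>?G\<^esub> inv\<^bsub>?G\<^esub> y \<in> ?H \<longleftrightarrow> (\<forall>i\<in>{1..d - 1}. x i \<ominus> y i \<in> I)"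
    if "x \<in> ?V" "y \<in> ?V" for x y
  proof -
    have xy: "x \<in> carrier ?G" "y \<in> carrier ?G" "x d = eval_ncpoly R x f" "y d = eval_ncpoly R y f"
      using that by (auto simp: graph_variety_def)
    have xyi: "x i \<in> carrier R" "y i \<in> carrier R" if "i \<in> {1..d}" for i
      using xy that by (auto simp: carrier_power_group)
    have "x \<otimes>\<^bsub>?G\<^esub> inv\<^bsub>?G\<^esub> y = (\<lambda>i\<in>{1..d}. x i \<ominus> y i)"
      unfolding inv_power_group[OF xy(2)] by (auto simp: power_group_def a_minus_def)
    then have "x \<otimes>\<^bsub>?G\<^esub> inv\<^bsub>?G\<^esub> y \<in> ?H \<longleftrightarrow> (\<forall>i\<in>{1..d}. x i \<ominus> y i \<in> I)" by auto
    moreover have "x d \<ominus> y d \<in> I" if "\<forall>i\<in>{1..d - 1}. x i \<ominus> y i \<in> I"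
      unfolding xy(3,4) by (rule eval_ncpoly_ideal_cong[OF I(1) f]) (use that xyi in auto)
    moreover have "{1..d} = insert d {1..d - 1}" using d by auto
    ultimately show ?thesis by auto
  qed
  have coset: "card {b \<in> carrier R. c \<ominus> b \<in> I} = card I" if c: "c \<in> carrier R" for c
  proof (rule bij_betw_same_card)
    have inv: "c \<ominus> (c \<ominus> b) = b" if "b \<in> carrier R" for b
      using that c by (simp add: a_minus_def minus_add r_neg1 r_neg2)
    show "bij_betw (\<lambda>b. c \<ominus> b) {b \<in> carrier R. c \<ominus> b \<in> I} I"
      by (rule bij_betwI[where g = "\<lambda>b. c \<ominus> b"]) (use c inv IR in auto)
  qed
  have fibre: "card {y \<in> ?V. (x, y) \<in> ?P} = card I ^ e" if x: "x \<in> ?V" for x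
  proof -
    have xR: "x i \<in> carrier R" if "i \<in> {1..d - 1}" for i
      using x that by (auto simp: graph_variety_def carrier_power_group)
    have "{y \<in> ?V. (x, y) \<in> ?P} = {y \<in> ?V. \<forall>i\<in>{1..d - 1}. y i \<in> {b \<in> carrier R. x i \<ominus> b \<in> I}}"
      using diff_iff[OF x] x by (auto simp: graph_variety_def carrier_power_group)
    also have "card \<dots> = (\<Prod>i\<in>{1..d - 1}. card {b \<in> carrier R. x i \<ominus> b \<in> I})"
      using d by (intro card_graph_variety_box f) auto
    also have "\<dots> = card I ^ e" using coset xR by (simp add: e_def)
    finally show ?thesis .
  qed
  have finV: "finite ?V" using V fin finite_subset by blast
  have "?P = Sigma ?V (\<lambda>x. {y \<in> ?V. (x, y) \<in> ?P})" by auto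
  then have "card ?P = (\<Sum>x\<in>?V. card {y \<in> ?V. (x, y) \<in> ?P})"
    using finV card_SigmaI[of ?V "\<lambda>x. {y \<in> ?V. (x, y) \<in> ?P}"] by simp
  also have "\<dots> = card (carrier R) ^ e * card I ^ e" using fibre cardV by simp
  finally have "card ?P = card (carrier R) ^ e * card I ^ e" .
  moreover have "card (carrier ?G) = card (carrier R) ^ d" "card ?H = card I ^ d"
    by (simp_all add: carrier_power_group card_PiE)
  ultimately have "N ^ e * a ^ e \<le> (N ^ e)\<^sup>2 * a ^ d / N ^ d + M\<^sup>2"
    using card_pairs_le[OF subgroup_power_group[OF sub]] cardV
    by (simp add: a_def N_def)
  also have "(N ^ e)\<^sup>2 * a ^ d / N ^ d = N ^ e * (a ^ e * (a / N))"
    using N by (simp add: e(1) power2_eq_square)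
  also have "M\<^sup>2 = N ^ e * (max C 0)\<^sup>2"
    using N by (simp add: M_def power_mult_distrib)
  finally have "N ^ e * a ^ e \<le> N ^ e * (a ^ e * (a / N) + (max C 0)\<^sup>2)"
    by (simp add: distrib_left)
  then have "a ^ e \<le> a ^ e * (a / N) + (max C 0)\<^sup>2"
    using N by (simp add: mult_le_cancel_left)
  also have "a ^ e * (a / N) \<le> a ^ e * (1 / 2)"
  proof (rule mult_left_mono)
    show "a / N \<le> 1 / 2"
      using card_proper_subgroup_le_half[OF finR sub I(2)] N
      by (simp add: a_def N_def field_simps)
  qed (simp add: a_def)
  also have "(max C 0)\<^sup>2 \<le> C\<^sup>2" by (auto simp: max_def)
  finally have "a ^ e \<le> 2 * C\<^sup>2" by simp
  moreover have "card I > 0"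
    using I.zero_closed IR finite_subset[OF IR finR] by (metis card_gt_0_iff empty_iff)
  then have "a \<ge> 1" by (simp add: a_def)
  then have "a \<le> a ^ e" using e(2) by (simp add: self_le_power)
  ultimately show ?thesis unfolding a_def by linarith
qed

theorem mainTheorem1:
  fixes d :: nat and f :: ncpoly and R :: "nat \<Rightarrow> 'a ring"
  assumes "d \<ge> 2"
    and "f \<in> ncpolys (d - 1)"
    and "\<And>i. ring (R i)"
    and "\<And>i. finite (carrier (R i))"
    and "\<And>i. \<one>\<^bsub>R i\<^esub> \<noteq> \<zero>\<^bsub>R i\<^esub>"
    and "filterlim (\<lambda>i. card (carrier (R i))) at_top sequentially"
    and "\<exists>C. \<forall>i. salem_set C d (R i) (graph_variety d f (R i))"
  shows "(\<forall>\<^sub>\<infinity>i. field (R i) \<or> is_small_matrix_ring d (R i)) \<and>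
         (f = sum_of_squares_poly (d - 1) \<longrightarrow> (\<forall>\<^sub>\<infinity>i. field (R i)))"
proof -
  obtain C where C: "\<And>i. salem_set C d (R i) (graph_variety d f (R i))" using assms(7) by blast
  \<comment> \<open>One natural number dominates both \<open>2 * C\<^sup>2\<close> for ideals and
    the constant for subrings; it is the same for all \<open>i\<close>.\<close>
  define B where "B = nat \<lceil>max 1 (4 * C\<^sup>2)\<rceil>"
  have B: "max 1 (4 * C\<^sup>2) \<le> real B" unfolding B_def by linarith
  have field: "field (R i)"
    if large: "card (carrier (R i)) > B * B ^ B" "card (carrier (R i)) > B ^ 3" for i
  proof -
    interpret unextended_ring "R i" by (rule unextended_ring.intro[OF assms(3)])
    show ?thesis
    proof (rule field_if_proper_ideals_and_subrings_small[OF assms(4,5) _ _ large])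
      fix I assume "ideal I (R i)" "I \<noteq> carrier (R i)"
      then have "real (card I) \<le> 2 * C\<^sup>2" by (rule card_proper_ideal_bound[OF assms(4,1,2) C])
      also have "\<dots> \<le> max 1 (4 * C\<^sup>2)" by (simp add: le_max_iff_disj)
      finally show "card I \<le> B" using B by linarith
    next
      fix A assume "subring A (R i)" "A \<noteq> carrier (R i)"
      then have "real ((card A)\<^sup>2) \<le> max 1 (4 * C\<^sup>2) * real (card (carrier (R i)))"
        by (rule card_proper_subring_bound[OF assms(4,1,2) C])
      also have "\<dots> \<le> real B * real (card (carrier (R i)))" using B by (rule mult_right_mono) simp
      finally show "(card A)\<^sup>2 \<le> B * card (carrier (R i))" by (simp only: of_nat_mult[symmetric] of_nat_le_iff)
    qed
  qed
  \<comment> \<open>Both thresholds are fixed while the orders tend to infinity, so only finitely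
    many rings fall below them.\<close>
  have "\<forall>\<^sub>F i in sequentially. max (B * B ^ B) (B ^ 3) < card (carrier (R i))"
    by (rule eventually_compose_filterlim[OF eventually_gt_at_top assms(6)])
  then have "\<forall>\<^sub>\<infinity>i. field (R i)"
    unfolding cofinite_eq_sequentially by (rule eventually_mono) (rule field; simp)
  then show ?thesis by (auto elim: MOST_mono)
qed

end
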